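(* The Koebe degree of any stacked $3$-polytope equals one.
   Context: A $3$-polytope is a $3$-dimensional convex polytope. A stacked $3$-polytope is a simplicial $3$-polytope obtained by starting with a $3$-simplex (tetrahedron) and successively adding vertices, each beyond a facet of the current polytope (stacking over that facet). Two polytopes are combinatorially equivalent if their face lattices are isomorphic; a realization of $P$ is a polytope in $\mathbb{R}^3$ combinatorially equivalent to $P$. A Koebe realization of a $3$-polytope $P$ is a realization $Q\subset\mathbb{R}^3$ of $P$ such that every edge (line segment) of $Q$ is tangent to the unit sphere $\mathbb{S}^2\subset\mathbb{R}^3$. For a realization $R$, $\mathbb{Q}[R]$ denotes the extension field of $\mathbb{Q}$ generated by all vertex coordinates of $R$. The Koebe degree $\kappa(P)$ is the minimum of the field extension degrees $|\mathbb{Q}[Q]:\mathbb{Q}|$, where $Q$ ranges over all Koebe realizations of $P$; thus $\kappa(P)=1$ means that $P$ has a Koebe realization with rational vertex coordinates. *)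

theory Defs
  imports
    "HOL-Algebra.Generated_Fields"
    "HOL-Algebra.Embedded_Algebras"
    "HOL-Algebra.Algebraic_Closure_Type"
    "HOL-Analysis.Analysis"
    "HOL-Library.Extended_Nat"
begin

definition three_polytope :: "(real^3) set \<Rightarrow> bool" where
  "three_polytope P \<longleftrightarrow> polytope P \<and> aff_dim P = 3"

definition simplicial_three_polytope :: "(real^3) set \<Rightarrow> bool" where
  "simplicial_three_polytope P \<longleftrightarrow> three_polytope P \<and> (\<forall>F. F facet_of P \<longrightarrow> 2 simplex F)"

text \<open>For a facet \<open>F\<close> of a full-dimensional polytope, the inequality \<open>a \<bullet> x \<le> b\<close> below is
  unique up to a positive factor.\<close>

definition beyond_halfspace :: "(real^3) set \<Rightarrow> (real^3) set \<Rightarrow> real^3 \<Rightarrow> bool" where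
  "beyond_halfspace P F v \<longleftrightarrow>
     (\<exists>a b. P \<subseteq> {x. a \<bullet> x \<le> b} \<and> F = P \<inter> {x. a \<bullet> x = b} \<and> a \<bullet> v > b)"

definition beneath_halfspace :: "(real^3) set \<Rightarrow> (real^3) set \<Rightarrow> real^3 \<Rightarrow> bool" where
  "beneath_halfspace P F v \<longleftrightarrow>
     (\<exists>a b. P \<subseteq> {x. a \<bullet> x \<le> b} \<and> F = P \<inter> {x. a \<bullet> x = b} \<and> a \<bullet> v < b)"

text \<open>The usual convention for stacking: a point beyond the facet \<open>F\<close> violates the inequality of
  \<open>F\<close> and strictly satisfies the inequalities of all other facets.\<close>

definition beyond_facet :: "(real^3) set \<Rightarrow> (real^3) set \<Rightarrow> real^3 \<Rightarrow> bool" where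
  "beyond_facet P F v \<longleftrightarrow>
     F facet_of P \<and> beyond_halfspace P F v \<and>
     (\<forall>G. G facet_of P \<and> G \<noteq> F \<longrightarrow> beneath_halfspace P G v)"

inductive obtained_by_stacking :: "(real^3) set \<Rightarrow> bool" where
  tetrahedron: "3 simplex T \<Longrightarrow> obtained_by_stacking T"
| stack: "obtained_by_stacking P \<Longrightarrow> beyond_facet P F v \<Longrightarrow>
          obtained_by_stacking (convex hull (insert v P))"

definition stacked_three_polytope :: "(real^3) set \<Rightarrow> bool" where
  "stacked_three_polytope P \<longleftrightarrow> simplicial_three_polytope P \<and> obtained_by_stacking P"

text \<open>Isomorphism of face lattices; \<^const>\<open>face_of\<close> includes the empty face and the polytope
  itself.\<close>

definition combinatorially_equivalent ::
  "'a::euclidean_space set \<Rightarrow> 'b::euclidean_space set \<Rightarrow> bool" where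
  "combinatorially_equivalent P Q \<longleftrightarrow>
     (\<exists>f. bij_betw f {F. F face_of P} {G. G face_of Q} \<and>
          (\<forall>F F'. F face_of P \<and> F' face_of P \<longrightarrow> (F \<subseteq> F' \<longleftrightarrow> f F \<subseteq> f F')))"

definition realization :: "(real^3) set \<Rightarrow> (real^3) set \<Rightarrow> bool" where
  "realization P Q \<longleftrightarrow> polytope Q \<and> combinatorially_equivalent P Q"

text \<open>The line spanned by the segment touches the sphere, and the point of contact lies on the
  segment.\<close>

definition tangent_to_unit_sphere :: "(real^3) set \<Rightarrow> bool" where
  "tangent_to_unit_sphere e \<longleftrightarrow> (\<exists>p\<in>e. affine hull e \<inter> sphere 0 1 = {p})"

definition koebe_realization :: "(real^3) set \<Rightarrow> (real^3) set \<Rightarrow> bool" where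
  "koebe_realization P Q \<longleftrightarrow>
     realization P Q \<and> (\<forall>e. e edge_of Q \<longrightarrow> tangent_to_unit_sphere e)"

definition vertex_coordinates :: "(real^3) set \<Rightarrow> real set" where
  "vertex_coordinates Q = {v $ i | v i. v extreme_point_of Q}"

text \<open>Every subfield of the reals contains \<open>\<rat>\<close>, so the subfield generated by the vertex coordinates
  is the extension of \<open>\<rat>\<close> generated by them.\<close>

definition coordinate_field :: "(real^3) set \<Rightarrow> real set" where
  "coordinate_field Q =
     generate_field (ring_of_type_algebra :: real ring) (vertex_coordinates Q)"

definition coordinate_degree :: "(real^3) set \<Rightarrow> enat" where
  "coordinate_degree Q =
     (if ring.finite_dimension (ring_of_type_algebra :: real ring) \<rat> (coordinate_field Q)
      then enat (ring.dim (ring_of_type_algebra :: real ring) \<rat> (coordinate_field Q))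
      else \<infinity>)"

text \<open>The infimum of a nonempty set of extended naturals is attained; that of the empty set is
  \<open>\<infinity>\<close>.\<close>

definition koebe_degree :: "(real^3) set \<Rightarrow> enat" where
  "koebe_degree P = Inf {coordinate_degree Q | Q. koebe_realization P Q}"

end

theory Submission
  imports Defs
begin

text \<open>Represent a point \<open>v\<close> outside the unit sphere by a multiple \<open>U\<close> of \<open>(v, 1)\<close>
  in Minkowski space, and a facet plane by its normal \<open>N\<close>. Scaling \<open>U\<close> so that its
  Lorentz square is 2, an edge touches the sphere iff the product of its two end vectors is \<open>- 2\<close>.
  Let \<open>abc\<close> be a facet with normal \<open>N\<close> of Lorentz square 8. Then \<open>e = N + a + b + c\<close>
  represents the unique point beyond \<open>abc\<close> that can be stacked with tangent edges, and the normals of the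
  new facets are \<open>N + 2 (a + b)\<close>, \<open>N + 2 (a + c)\<close>, \<open>N + 2 (b + c)\<close>.
  No irrationality enters. Distinct normals have nonpositive product, which forces \<open>e\<close> beneath all other
  facets, and the time components of the normals stay nonnegative, which keeps \<open>e\<close> a finite point.
  The regular tetrahedron inscribed in the cube \<open>{- 1, 1}^3\<close> starts the construction. Repeating the
  stackings of the given polytope yields a realization of it, since the face lattice only depends on the vertex
  sets of the facets.\<close>

section \<open>The Lorentz form and barycentric coordinates\<close>

definition lorentz :: "(real^3) \<times> real \<Rightarrow> (real^3) \<times> real \<Rightarrow> real" where
  "lorentz u w = fst u \<bullet> fst w - snd u * snd w"

lemma lorentz_commute: "lorentz u w = lorentz w u"
  by (simp add: lorentz_def inner_commute mult.commute)

lemma lorentz_add_left: "lorentz (u + v) w = lorentz u w + lorentz v w"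
  by (simp add: lorentz_def algebra_simps inner_add_left)

lemma lorentz_add_right: "lorentz u (v + w) = lorentz u v + lorentz u w"
  by (simp add: lorentz_def algebra_simps inner_add_right)

lemma lorentz_diff_left: "lorentz (u - v) w = lorentz u w - lorentz v w"
  by (simp add: lorentz_def algebra_simps inner_diff_left)

lemma lorentz_minus_left: "lorentz (- u) w = - lorentz u w"
  by (simp add: lorentz_def)

lemma lorentz_scaleR_left: "lorentz (c *\<^sub>R u) w = c * lorentz u w"
  by (simp add: lorentz_def algebra_simps)

lemma lorentz_scaleR_right: "lorentz u (c *\<^sub>R w) = c * lorentz u w"
  by (simp add: lorentz_def algebra_simps)

lemma lorentz_sum_left: "lorentz (\<Sum>i\<in>A. f i) w = (\<Sum>i\<in>A. lorentz (f i) w)"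
  by (induction A rule: infinite_finite_induct) (simp_all add: lorentz_add_left, simp_all add: lorentz_def)

lemma lorentz_sum_right: "lorentz w (\<Sum>i\<in>A. f i) = (\<Sum>i\<in>A. lorentz w (f i))"
  using lorentz_sum_left lorentz_commute by (metis (mono_tags, lifting) sum.cong)

text \<open>The form thus serves twice: paired with \<open>(x, 1)\<close>, a vector \<open>N\<close>
  tests the inequality \<open>fst N \<bullet> x \<le> snd N\<close>, so facet planes and tangency
  are handled by one bilinear form.\<close>

lemma lorentz_point: "lorentz N (x, 1) = fst N \<bullet> x - snd N"
  by (simp add: lorentz_def)

text \<open>Up to negative factors the functionals \<open>M i\<close> are barycentric coordinates:
  by the zeros off the diagonal, \<open>M i\<close> reads off the \<open>i\<close>-th coefficient of
  a combination of the \<open>q j\<close>. Affine independence and the signs of the coefficients of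
  \<open>x\<close> both follow.\<close>

lemma lorentz_simplex_hull:
  fixes q :: "'i \<Rightarrow> real^3"
  assumes "finite I" "card I = 4"
    and off: "\<And>i j. i \<in> I \<Longrightarrow> j \<in> I \<Longrightarrow> i \<noteq> j \<Longrightarrow> lorentz (M i) (q j, 1) = 0"
    and neg: "\<And>i. i \<in> I \<Longrightarrow> lorentz (M i) (q i, 1) < 0"
    and x: "\<And>i. i \<in> I \<Longrightarrow> lorentz (M i) (x, 1) \<le> 0"
  shows "x \<in> convex hull (q ` I)"
proof -
  have inj: "inj_on q I"
    using off neg by (metis inj_onI less_irrefl)
  \<comment> \<open>The coefficients may have any sum: sum 0 excludes an affine dependence, sum 1
    gives the coordinates of \<open>x\<close>.\<close>
  have eval: "lorentz (M i) (\<Sum>j\<in>I. c j *\<^sub>R q j, \<Sum>j\<in>I. c j) = c i * lorentz (M i) (q i, 1)"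
    if "i \<in> I" for c i
  proof -
    have "(\<Sum>j\<in>I. c j *\<^sub>R q j, \<Sum>j\<in>I. c j) = (\<Sum>j\<in>I. c j *\<^sub>R (q j, 1::real))"
      by (rule prod_eqI) (simp_all add: fst_sum snd_sum)
    hence "lorentz (M i) (\<Sum>j\<in>I. c j *\<^sub>R q j, \<Sum>j\<in>I. c j) = (\<Sum>j\<in>I. c j * lorentz (M i) (q j, 1))"
      by (simp only: lorentz_sum_right lorentz_scaleR_right)
    also have "\<dots> = (\<Sum>j\<in>I. if j = i then c i * lorentz (M i) (q i, 1) else 0)"
      using off that by (intro sum.cong) auto
    also have "\<dots> = c i * lorentz (M i) (q i, 1)"
      using that assms(1) by simp
    finally show ?thesis .
  qed
  have "\<not> affine_dependent (q ` I)"
  proof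
    assume "affine_dependent (q ` I)"
    then obtain c where c: "sum c (q ` I) = 0" "\<exists>v\<in>q ` I. c v \<noteq> 0" "(\<Sum>v\<in>q ` I. c v *\<^sub>R v) = 0"
      using affine_dependent_explicit_finite[of "q ` I"] assms(1) by auto
    have s: "(\<Sum>j\<in>I. c (q j)) = 0" "(\<Sum>j\<in>I. c (q j) *\<^sub>R q j) = 0"
      using c inj by (simp_all add: sum.reindex)
    have "c (q i) = 0" if "i \<in> I" for i
      using eval[OF that, of "\<lambda>j. c (q j)"] neg[OF that] s by (simp add: lorentz_def)
    with c(2) show False by auto
  qed
  hence "aff_dim (q ` I) = 3"
    using aff_dim_affine_independent[of "q ` I"] card_image[OF inj] assms(2) by simp
  hence "affine hull (q ` I) = UNIV"
    by (simp add: aff_dim_eq_full[symmetric])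
  then obtain u where u: "sum u (q ` I) = 1" "(\<Sum>v\<in>q ` I. u v *\<^sub>R v) = x"
    using affine_hull_finite[of "q ` I"] assms(1) by auto
  have "(\<Sum>j\<in>I. u (q j)) = 1" "(\<Sum>j\<in>I. u (q j) *\<^sub>R q j) = x"
    using u inj by (simp_all add: sum.reindex)
  moreover have "u (q i) \<ge> 0" if "i \<in> I" for i
    using eval[OF that, of "\<lambda>j. u (q j)"] neg[OF that] x[OF that] calculation
    by (simp add: mult_le_0_iff)
  ultimately show ?thesis
    using convex_sum[of I "convex hull (q ` I)" "\<lambda>j. u (q j)" q] assms(1)
    by (simp add: hull_inc)
qed

section \<open>The face lattice from vertex-facet incidences\<close>

definition vertex_set :: "nat \<Rightarrow> (nat \<Rightarrow> real^3) \<Rightarrow> (real^3) set \<Rightarrow> nat set" where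
  "vertex_set n p G = {i. i < n \<and> p i \<in> G}"

text \<open>A model of the face lattice that mentions only labels. The factor \<open>{..<n}\<close>
  lets the empty subfamily stand for the whole polytope.\<close>

definition face_vertex_sets :: "nat \<Rightarrow> nat set set \<Rightarrow> nat set set" where
  "face_vertex_sets n \<F> = {{..<n} \<inter> \<Inter>\<T> | \<T>. \<T> \<subseteq> \<F>}"

text \<open>\<open>N T = (a, b)\<close> stands for the inequality \<open>a \<bullet> x \<le> b\<close> of the facet with vertex labels \<open>T\<close>.\<close>

locale facet_frame =
  fixes P :: "(real^3) set" and n :: nat and \<F> :: "nat set set"
    and p :: "nat \<Rightarrow> real^3" and N :: "nat set \<Rightarrow> (real^3) \<times> real"
  assumes hull: "P = convex hull (p ` {..<n})"
    and nonempty: "\<F> \<noteq> {}"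
    and subset: "T \<in> \<F> \<Longrightarrow> T \<subseteq> {..<n}"
    and card3: "T \<in> \<F> \<Longrightarrow> card T = 3"
    and on_facet: "T \<in> \<F> \<Longrightarrow> i \<in> T \<Longrightarrow> lorentz (N T) (p i, 1) = 0"
    and off_facet: "T \<in> \<F> \<Longrightarrow> i < n \<Longrightarrow> i \<notin> T \<Longrightarrow> lorentz (N T) (p i, 1) < 0"
    and covers: "(\<And>T. T \<in> \<F> \<Longrightarrow> lorentz (N T) (x, 1) \<le> 0) \<Longrightarrow> x \<in> P"
    and adjacent: "T \<in> \<F> \<Longrightarrow> i \<in> T \<Longrightarrow> \<exists>G\<in>\<F>. G \<inter> T = T - {i}"
begin

lemma finite_facet: "T \<in> \<F> \<Longrightarrow> finite T"
  using subset finite_subset by blast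

lemma finite_facets: "finite \<F>"
  using subset by (intro finite_subset[of \<F> "Pow {..<n}"]) auto

lemma polytope_P: "polytope P"
  unfolding polytope_def using hull by blast

lemma convex_P: "convex P"
  using hull by simp

lemma vertex_in: "i < n \<Longrightarrow> p i \<in> P"
  unfolding hull by (rule hull_inc) simp

lemma on_facet_iff: "T \<in> \<F> \<Longrightarrow> i < n \<Longrightarrow> lorentz (N T) (p i, 1) = 0 \<longleftrightarrow> i \<in> T"
  using on_facet off_facet by force

lemma vertex_le: "T \<in> \<F> \<Longrightarrow> i < n \<Longrightarrow> lorentz (N T) (p i, 1) \<le> 0"
  using on_facet off_facet by (cases "i \<in> T") (auto intro: less_imp_le)

lemma le_on_P: 
  assumes "T \<in> \<F>" "x \<in> P" shows "lorentz (N T) (x, 1) \<le> 0"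
proof -
  have "P \<subseteq> {x. fst (N T) \<bullet> x \<le> snd (N T)}"
    unfolding hull using vertex_le[OF assms(1)]
    by (intro hull_minimal) (auto simp: lorentz_point convex_halfspace_le)
  with assms(2) show ?thesis by (auto simp: lorentz_point)
qed

lemma facet_hyperplane_face:
  assumes "T \<in> \<F>" shows "(P \<inter> {x. lorentz (N T) (x, 1) = 0}) face_of P"
  using face_of_Int_supporting_hyperplane_le[OF convex_P, of "fst (N T)" "snd (N T)"] le_on_P[OF assms]
  by (simp add: lorentz_point)

text \<open>A face of a convex hull is the hull of some of the generators, so no information is lost
  in passing from faces to label sets.\<close>

lemma face_eq_hull:
  assumes "G face_of P" shows "G = convex hull (p ` vertex_set n p G)"
proof
  have "compact (p ` {..<n})" by (simp add: finite_imp_compact)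
  from face_of_convex_hull_subset[OF this] assms
  obtain S where S: "S \<subseteq> p ` {..<n}" "G = convex hull S"
    unfolding hull by blast
  have "S \<subseteq> p ` vertex_set n p G"
    using S hull_subset[of S convex] unfolding vertex_set_def by blast
  thus "G \<subseteq> convex hull (p ` vertex_set n p G)"
    unfolding S(2) by (rule hull_mono)
  show "convex hull (p ` vertex_set n p G) \<subseteq> G"
    using face_of_imp_convex[OF assms] by (intro hull_minimal) (auto simp: vertex_set_def)
qed

lemma vertex_set_mono_iff:
  assumes "G face_of P" "G' face_of P"
  shows "G \<subseteq> G' \<longleftrightarrow> vertex_set n p G \<subseteq> vertex_set n p G'"
proof
  assume "vertex_set n p G \<subseteq> vertex_set n p G'"
  hence "convex hull (p ` vertex_set n p G) \<subseteq> convex hull (p ` vertex_set n p G')"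
    by (intro hull_mono) auto
  thus "G \<subseteq> G'" using face_eq_hull assms by metis
qed (auto simp: vertex_set_def)

text \<open>A nonempty face \<open>G\<close> is cut out by the facet planes that contain it. Let
  \<open>p i\<close> lie on all of these and let \<open>x\<close> be a relative interior point of
  \<open>G\<close>. Pushing \<open>x\<close> slightly away from \<open>p i\<close> keeps the tight
  inequalities tight and, by continuity, the finitely many others strict. So the pushed point is in
  \<open>P\<close> by \<open>covers\<close>, and the face property of \<open>G\<close>, applied to
  the segment from \<open>p i\<close> to it through \<open>x\<close>, puts \<open>p i\<close> into
  \<open>G\<close>.\<close>

lemma vertex_set_face:
  assumes G: "G face_of P" shows "vertex_set n p G \<in> face_vertex_sets n \<F>"
proof (cases "G = {}")
  case True
  obtain T where T: "T \<in> \<F>" using nonempty by blast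
  \<comment> \<open>Either \<open>T\<close> misses \<open>i\<close>, or its neighbour across the
    ridge \<open>T - {i}\<close> does.\<close>
  have "i \<notin> \<Inter>\<F>" for i
    using adjacent[OF T, of i] T by blast
  hence "vertex_set n p G = {..<n} \<inter> \<Inter>\<F>" using True by (auto simp: vertex_set_def)
  thus ?thesis unfolding face_vertex_sets_def by blast
next
  case False
  define \<T> where "\<T> = {T \<in> \<F>. \<forall>x\<in>G. lorentz (N T) (x, 1) = 0}"
  have "vertex_set n p G = {..<n} \<inter> \<Inter>\<T>"
  proof (intro equalityI subsetI)
    fix i assume "i \<in> vertex_set n p G"
    thus "i \<in> {..<n} \<inter> \<Inter>\<T>"
      using on_facet_iff by (auto simp: vertex_set_def \<T>_def)
  next
    fix i assume i: "i \<in> {..<n} \<inter> \<Inter>\<T>"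
    have cG: "convex G" using face_of_imp_convex G by blast
    obtain x where x: "x \<in> rel_interior G"
      using rel_interior_eq_empty[OF cG] False by blast
    hence xG: "x \<in> G" using rel_interior_subset by blast
    hence xP: "x \<in> P" using face_of_imp_subset[OF G] by blast
    have neg: "lorentz (N T) (x, 1) < 0" if T: "T \<in> \<F> - \<T>" for T
    proof (rule ccontr)
      assume "\<not> ?thesis"
      hence "lorentz (N T) (x, 1) = 0" using le_on_P[of T x] T xP by simp
      \<comment> \<open>A face of \<open>P\<close> that meets the relative interior of
        \<open>G\<close> contains all of \<open>G\<close>.\<close>
      hence "G \<subseteq> P \<inter> {x. lorentz (N T) (x, 1) = 0}"
        using subset_of_face_of[OF facet_hyperplane_face[of T], of G] T x xP face_of_imp_subset[OF G]
        by blast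
      with T show False unfolding \<T>_def by blast
    qed
    define z where "z \<epsilon> = x + \<epsilon> *\<^sub>R (x - p i)" for \<epsilon> :: real
    have z: "lorentz (N T) (z \<epsilon>, 1) = (1 + \<epsilon>) * lorentz (N T) (x, 1) - \<epsilon> * lorentz (N T) (p i, 1)"
      for T \<epsilon> by (simp add: lorentz_point z_def inner_simps algebra_simps)
    have "\<forall>T\<in>\<F> - \<T>. \<forall>\<^sub>F \<epsilon> in at_right 0. lorentz (N T) (z \<epsilon>, 1) < 0"
    proof
      fix T assume T: "T \<in> \<F> - \<T>"
      have "((\<lambda>\<epsilon>. (1 + \<epsilon>) * lorentz (N T) (x, 1) - \<epsilon> * lorentz (N T) (p i, 1)) \<longlongrightarrow>
          (1 + 0) * lorentz (N T) (x, 1) - 0 * lorentz (N T) (p i, 1)) (at_right 0)"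
        by (intro tendsto_intros)
      thus "\<forall>\<^sub>F \<epsilon> in at_right 0. lorentz (N T) (z \<epsilon>, 1) < 0"
        unfolding z using neg[OF T] by (intro order_tendstoD(2)) auto
    qed
    hence "\<forall>\<^sub>F \<epsilon> in at_right 0. \<forall>T\<in>\<F> - \<T>. lorentz (N T) (z \<epsilon>, 1) < 0"
      using finite_facets by (intro eventually_ball_finite) auto
    moreover have "\<forall>\<^sub>F \<epsilon> in at_right (0::real). \<epsilon> > 0"
      by (simp add: eventually_at_right_less)
    ultimately have "\<forall>\<^sub>F \<epsilon> in at_right 0. (\<forall>T\<in>\<F> - \<T>. lorentz (N T) (z \<epsilon>, 1) < 0) \<and> \<epsilon> > 0"
      by (rule eventually_conj)
    then obtain \<epsilon> where \<epsilon>: "\<epsilon> > 0" "\<And>T. T \<in> \<F> - \<T> \<Longrightarrow> lorentz (N T) (z \<epsilon>, 1) < 0"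
      using eventually_happens by (metis (no_types, lifting) trivial_limit_at_right_real)
    have "z \<epsilon> \<in> P"
    proof (rule covers)
      fix T assume T: "T \<in> \<F>"
      show "lorentz (N T) (z \<epsilon>, 1) \<le> 0"
      proof (cases "T \<in> \<T>")
        case True
        hence "lorentz (N T) (x, 1) = 0" "lorentz (N T) (p i, 1) = 0"
          using xG i on_facet[OF T] by (auto simp: \<T>_def)
        thus ?thesis using z by simp
      next
        case False
        thus ?thesis using \<epsilon>(2)[of T] T by simp
      qed
    qed
    \<comment> \<open>If \<open>x = p i\<close>, then \<open>p i\<close> is in \<open>G\<close>
      already.\<close>
    moreover have "x \<in> open_segment (p i) (z \<epsilon>)" if "x \<noteq> p i"
    proof -
      have "(1 + \<epsilon>) *\<^sub>R ((1 - 1 / (1 + \<epsilon>)) *\<^sub>R p i + (1 / (1 + \<epsilon>)) *\<^sub>R z \<epsilon>)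
          = \<epsilon> *\<^sub>R p i + z \<epsilon>"
        using \<epsilon>(1) by (simp add: scaleR_add_right right_diff_distrib)
      also have "\<dots> = (1 + \<epsilon>) *\<^sub>R x" by (simp add: z_def algebra_simps)
      finally have "x = (1 - 1 / (1 + \<epsilon>)) *\<^sub>R p i + (1 / (1 + \<epsilon>)) *\<^sub>R z \<epsilon>"
        using \<epsilon>(1) by simp
      moreover have "p i \<noteq> z \<epsilon>"
      proof
        assume "p i = z \<epsilon>"
        hence "(1 + \<epsilon>) *\<^sub>R (x - p i) = 0" by (simp add: z_def algebra_simps)
        thus False using \<epsilon>(1) that by simp
      qed
      ultimately show ?thesis
        unfolding in_segment using \<epsilon>(1) by (intro conjI exI[of _ "1 / (1 + \<epsilon>)"]) auto
    qed
    ultimately have "p i \<in> G"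
      using xG face_ofD[OF G, of x "p i" "z \<epsilon>"] vertex_in i by blast
    thus "i \<in> vertex_set n p G" using i by (simp add: vertex_set_def)
  qed
  moreover have "\<T> \<subseteq> \<F>" by (auto simp: \<T>_def)
  ultimately show ?thesis unfolding face_vertex_sets_def by blast
qed

lemma face_vertex_sets_realized:
  assumes "A \<in> face_vertex_sets n \<F>"
  shows "(convex hull (p ` A)) face_of P" "vertex_set n p (convex hull (p ` A)) = A"
proof -
  obtain \<T> where T: "\<T> \<subseteq> \<F>" "A = {..<n} \<inter> \<Inter>\<T>"
    using assms unfolding face_vertex_sets_def by blast
  \<comment> \<open>With planes in place of a hull, \<open>G\<close> is visibly an intersection of
    faces, and its labels are read off from the incidences.\<close>
  define G where "G = P \<inter> (\<Inter>T\<in>\<T>. {x. lorentz (N T) (x, 1) = 0})"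
  have G: "G face_of P"
  proof (cases "\<T> = {}")
    case True
    thus ?thesis using convex_P by (simp add: G_def face_of_refl)
  next
    case False
    have "G = \<Inter>((\<lambda>T. P \<inter> {x. lorentz (N T) (x, 1) = 0}) ` \<T>)"
      using False by (auto simp: G_def)
    also have "\<dots> face_of P"
      using False T(1) facet_hyperplane_face by (intro face_of_Inter) auto
    finally show ?thesis .
  qed
  have A: "vertex_set n p G = A"
    unfolding T(2) vertex_set_def G_def using T(1) on_facet_iff vertex_in by fast
  hence "convex hull (p ` A) = G" using face_eq_hull[OF G] by simp
  thus "(convex hull (p ` A)) face_of P" "vertex_set n p (convex hull (p ` A)) = A"
    using G A by auto
qed

lemma bij_vertex_set: "bij_betw (vertex_set n p) {G. G face_of P} (face_vertex_sets n \<F>)"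
  unfolding bij_betw_def
proof
  show "inj_on (vertex_set n p) {G. G face_of P}"
    using face_eq_hull by (metis (no_types, lifting) inj_onI mem_Collect_eq)
  show "vertex_set n p ` {G. G face_of P} = face_vertex_sets n \<F>"
    using vertex_set_face face_vertex_sets_realized by (force simp: image_iff)
qed

text \<open>Intersecting \<open>T\<close> with its neighbours across the ridges
  \<open>T - {i}\<close>, for \<open>i\<close> in \<open>T - A\<close>, removes exactly the labels
  outside \<open>A\<close>. Combinatorially, facets are therefore simplices.\<close>

lemma subset_face_vertex_sets:
  assumes "T \<in> \<F>" "A \<subseteq> T" shows "A \<in> face_vertex_sets n \<F>"
proof -
  have "\<forall>i\<in>T. \<exists>G. G \<in> \<F> \<and> G \<inter> T = T - {i}" using adjacent[OF assms(1)] by blast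
  then obtain G where G: "\<forall>i\<in>T. G i \<in> \<F> \<and> G i \<inter> T = T - {i}" by metis
  have "A = {..<n} \<inter> \<Inter>(insert T (G ` (T - A)))"
  proof (intro equalityI subsetI)
    fix i assume i: "i \<in> {..<n} \<inter> \<Inter>(insert T (G ` (T - A)))"
    show "i \<in> A"
    proof (rule ccontr)
      assume "i \<notin> A"
      with i have "i \<in> T" "i \<in> G i" by auto
      with G show False by blast
    qed
  next
    fix i assume i: "i \<in> A"
    have "i \<in> G j" if "j \<in> T - A" for j
      using G that i assms(2) by blast
    with i show "i \<in> {..<n} \<inter> \<Inter>(insert T (G ` (T - A)))"
      using subset[OF assms(1)] assms(2) by blast
  qed
  moreover have "insert T (G ` (T - A)) \<subseteq> \<F>" using G assms(1) by blast
  ultimately show ?thesis unfolding face_vertex_sets_def by blast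
qed

text \<open>Subsets of \<open>T\<close> span faces of \<open>P\<close>, and distinct label sets give
  distinct faces. Adding one label therefore raises the dimension, starting from -1 at the empty
  face.\<close>

lemma aff_dim_face_lower:
  assumes "T \<in> \<F>" "A \<subseteq> T" shows "int (card A) - 1 \<le> aff_dim (convex hull (p ` A))"
proof -
  have "finite A" using assms finite_facet finite_subset by blast
  thus ?thesis using assms(2)
  proof (induction A rule: finite_induct)
    case (insert a A)
    let ?G = "convex hull (p ` A)" and ?H = "convex hull (p ` insert a A)"
    have sets: "A \<in> face_vertex_sets n \<F>" "insert a A \<in> face_vertex_sets n \<F>"
      using subset_face_vertex_sets[OF assms(1)] insert.prems by auto
    have "?G \<subseteq> ?H" by (intro hull_mono) auto
    hence "?G face_of ?H"
      using face_of_subset[OF face_vertex_sets_realized(1)[OF sets(1)]]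
        face_of_imp_subset[OF face_vertex_sets_realized(1)[OF sets(2)]] by blast
    moreover have "?G \<noteq> ?H"
      using face_vertex_sets_realized(2)[OF sets(1)] face_vertex_sets_realized(2)[OF sets(2)] insert.hyps
      by auto
    ultimately have "aff_dim ?G < aff_dim ?H" by (intro face_of_aff_dim_lt) auto
    thus ?case using insert by simp
  qed simp
qed

lemma facet_ne_vertices: assumes "T \<in> \<F>" shows "T \<noteq> {..<n}"
proof -
  obtain i where "i \<in> T" using card3[OF assms] by fastforce
  then obtain G where G: "G \<in> \<F>" "G \<inter> T = T - {i}" "i \<in> T" using adjacent[OF assms] by blast
  have "\<not> G \<subseteq> T"
  proof
    assume "G \<subseteq> T"
    hence "G = T" using card3[OF assms] card3[OF G(1)] finite_facet[OF assms] by (simp add: card_subset_eq)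
    thus False using G by blast
  qed
  thus ?thesis using subset[OF G(1)] by blast
qed

lemma vertices_face_vertex_sets: "{..<n} \<in> face_vertex_sets n \<F>"
  unfolding face_vertex_sets_def by (intro CollectI exI[of _ "{}"]) auto

lemma aff_dim_facet_less: 
  assumes "T \<in> \<F>" shows "aff_dim (convex hull (p ` T)) < aff_dim P"
proof (rule face_of_aff_dim_lt[OF convex_P])
  note T = face_vertex_sets_realized[OF subset_face_vertex_sets[OF assms subset_refl]]
  show "(convex hull (p ` T)) face_of P" by (rule T)
  show "convex hull (p ` T) \<noteq> P"
    using T(2) facet_ne_vertices[OF assms] face_vertex_sets_realized(2)[OF vertices_face_vertex_sets]
    unfolding hull by metis
qed

lemma aff_dim_P: "aff_dim P = 3"
proof -
  obtain T where "T \<in> \<F>" using nonempty by blast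
  hence "aff_dim P \<ge> 3"
    using aff_dim_facet_less[of T] aff_dim_face_lower[of T T] card3[of T] by simp
  thus ?thesis using aff_dim_le_DIM[of P] by simp
qed

lemma facet_face:
  assumes "T \<in> \<F>"
  shows "P \<inter> {x. lorentz (N T) (x, 1) = 0} = convex hull (p ` T)"
proof -
  have "vertex_set n p (P \<inter> {x. lorentz (N T) (x, 1) = 0}) = T"
    using vertex_in on_facet_iff[OF assms] subset[OF assms] by (auto simp: vertex_set_def)
  thus ?thesis using face_eq_hull[OF facet_hyperplane_face[OF assms]] by simp
qed

lemma facet_of_facet:
  assumes "T \<in> \<F>" shows "(convex hull (p ` T)) facet_of P"
  unfolding facet_of_def
  using face_vertex_sets_realized(1)[OF subset_face_vertex_sets[OF assms subset_refl]]
    aff_dim_face_lower[OF assms subset_refl] aff_dim_facet_less[OF assms] card3[OF assms] aff_dim_P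
  by fastforce

lemma proper_face_in_facet:
  assumes "A \<in> face_vertex_sets n \<F>" "A \<noteq> {..<n}" obtains T where "T \<in> \<F>" "A \<subseteq> T"
  using assms unfolding face_vertex_sets_def by auto

text \<open>A facet is a proper face, so its labels lie in some \<open>T\<close>; it is then a face
  of the hull of \<open>T\<close> with the same dimension 2, hence equal to it.\<close>

lemma facet_ofE:
  assumes "F facet_of P" obtains T where "T \<in> \<F>" "F = convex hull (p ` T)"
proof -
  have F: "F face_of P" "aff_dim F = 2" using assms aff_dim_P by (auto simp: facet_of_def)
  have "vertex_set n p F \<noteq> {..<n}" using face_eq_hull[OF F(1)] F(2) aff_dim_P unfolding hull by force
  then obtain T where T: "T \<in> \<F>" "vertex_set n p F \<subseteq> T"
    using proper_face_in_facet vertex_set_face[OF F(1)] by blast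
  let ?H = "convex hull (p ` T)"
  have H: "?H face_of P" using facet_of_facet[OF T(1)] by (simp add: facet_of_def)
  have "convex hull (p ` vertex_set n p F) \<subseteq> ?H" using T(2) by (intro hull_mono image_mono)
  hence "F \<subseteq> ?H" using face_eq_hull[OF F(1)] by simp
  hence "F face_of ?H" using face_of_subset[OF F(1)] face_of_imp_subset[OF H] by blast
  moreover have "aff_dim ?H = 2" using facet_of_facet[OF T(1)] aff_dim_P by (simp add: facet_of_def)
  ultimately have "F = ?H" using face_of_aff_dim_lt[of ?H F] F(2) by fastforce
  with T(1) that show ?thesis by blast
qed

end

text \<open>Both face lattices are isomorphic to \<open>face_vertex_sets n \<F>\<close>, in which
  neither the points nor the normals occur.\<close>

lemma combinatorially_equivalent_frames:
  assumes "facet_frame P n \<F> p N" "facet_frame Q n \<F> q M"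
  shows "combinatorially_equivalent P Q"
proof -
  interpret P: facet_frame P n \<F> p N by fact
  interpret Q: facet_frame Q n \<F> q M by fact
  let ?f = "inv_into {G. G face_of Q} (vertex_set n q) \<circ> vertex_set n p"
  have "bij_betw ?f {G. G face_of P} {G. G face_of Q}"
    using P.bij_vertex_set bij_betw_inv_into[OF Q.bij_vertex_set] by (rule bij_betw_trans)
  moreover have "G \<subseteq> G' \<longleftrightarrow> ?f G \<subseteq> ?f G'" if G: "G face_of P" "G' face_of P" for G G'
  proof -
    have f: "?f H face_of Q" "vertex_set n q (?f H) = vertex_set n p H" if "H face_of P" for H
    proof -
      have "vertex_set n p H \<in> vertex_set n q ` {G. G face_of Q}"
        using P.vertex_set_face[OF that] Q.bij_vertex_set by (simp add: bij_betw_def)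
      thus "?f H face_of Q" "vertex_set n q (?f H) = vertex_set n p H"
        using inv_into_into[of "vertex_set n p H" "vertex_set n q" "{G. G face_of Q}"]
          f_inv_into_f[of "vertex_set n p H" "vertex_set n q" "{G. G face_of Q}"] by auto
    qed
    show ?thesis
      using P.vertex_set_mono_iff[OF G] Q.vertex_set_mono_iff[of "?f G" "?f G'"] f G by metis
  qed
  ultimately show ?thesis unfolding combinatorially_equivalent_def by blast
qed

section \<open>Stacking\<close>

text \<open>The new vertex always gets the label \<open>n\<close>, so two frames with equal labels
  still have equal labels after stacking both over the same \<open>T\<close>.\<close>

definition stack_facets :: "nat \<Rightarrow> nat set \<Rightarrow> nat set set \<Rightarrow> nat set set" where
  "stack_facets n T \<F> = (\<F> - {T}) \<union> (\<lambda>i. insert n (T - {i})) ` T"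

context facet_frame
begin

lemma new_notin_facet: "T \<in> \<F> \<Longrightarrow> n \<notin> T"
  using subset by blast

lemma stack_facets_cases:
  assumes "S \<in> stack_facets n T \<F>"
  obtains (old) "S \<in> \<F>" "S \<noteq> T" | (new) i where "i \<in> T" "S = insert n (T - {i})"
  using assms unfolding stack_facets_def by blast

text \<open>If an old facet loses \<open>T\<close> as a neighbour, the new triangle over their
  common ridge takes its place. A new triangle over \<open>T - {i}\<close> borders the former
  neighbour of \<open>T\<close> there, and the other new triangles along its edges through
  \<open>n\<close>.\<close>

lemma stack_facets_adjacent:
  assumes T: "T \<in> \<F>" and S: "S \<in> stack_facets n T \<F>" "j \<in> S"
  shows "\<exists>G\<in>stack_facets n T \<F>. G \<inter> S = S - {j}"
  using S(1)
proof (cases rule: stack_facets_cases)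
  case old
  obtain G where G: "G \<in> \<F>" "G \<inter> S = S - {j}" using adjacent old(1) S(2) by blast
  show ?thesis
  proof (cases "G = T")
    case False
    with G show ?thesis unfolding stack_facets_def by blast
  next
    case True
    have fin: "finite S" "finite T" using old(1) T finite_facet by auto
    have "card (T \<inter> S) = 2" using G(2) True card3[OF old(1)] S(2) fin by simp
    moreover have "card (T - S) = card T - card (T \<inter> S)" using fin by (simp add: card_Diff_subset_Int)
    ultimately have "card (T - S) = 1" using card3[OF T] by simp
    then obtain k where k: "T - S = {k}" using card_1_singletonE by blast
    hence "T - {k} = T \<inter> S" by blast
    hence "insert n (T - {k}) \<inter> S = S - {j}" using G(2) True new_notin_facet[OF old(1)] by blast
    moreover have "insert n (T - {k}) \<in> stack_facets n T \<F>"
      unfolding stack_facets_def using k by blast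
    ultimately show ?thesis by blast
  qed
next
  case (new i)
  note n = new_notin_facet[OF T]
  show ?thesis
  proof (cases "j = n")
    case True
    obtain G where G: "G \<in> \<F>" "G \<inter> T = T - {i}" using adjacent[OF T new(1)] by blast
    have "G \<inter> S = S - {j}" using G new_notin_facet[OF G(1)] n True new by blast
    moreover have "G \<noteq> T" using G(2) new(1) by blast
    ultimately show ?thesis using G(1) unfolding stack_facets_def by blast
  next
    case False
    hence j: "j \<in> T" "j \<noteq> i" using S(2) new by auto
    have "insert n (T - {j}) \<inter> S = S - {j}" using new(2) j False n by blast
    moreover have "insert n (T - {j}) \<in> stack_facets n T \<F>" unfolding stack_facets_def using j by blast
    ultimately show ?thesis by blast
  qed
qed

text \<open>The new normals are parameters, because an arbitrary stacking takes them from a pencil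
  of planes and a packing has its own formula. For \<open>covers\<close>, a point on the inner side
  of \<open>T\<close> is in the old polytope; any other point is in the tetrahedron over
  \<open>T\<close> with apex \<open>v\<close>.\<close>

lemma stack_frame:
  assumes T: "T \<in> \<F>" and beyond: "lorentz (N T) (v, 1) > 0"
    and beneath: "\<And>S. S \<in> \<F> \<Longrightarrow> S \<noteq> T \<Longrightarrow> lorentz (N S) (v, 1) < 0"
    and old: "\<And>S. S \<in> \<F> \<Longrightarrow> N' S = N S"
    and new0: "\<And>i. i \<in> T \<Longrightarrow> lorentz (N' (insert n (T - {i}))) (v, 1) = 0"
    and new1: "\<And>i j. i \<in> T \<Longrightarrow> j \<in> T - {i} \<Longrightarrow> lorentz (N' (insert n (T - {i}))) (p j, 1) = 0"
    and new2: "\<And>i j. i \<in> T \<Longrightarrow> j < n \<Longrightarrow> j \<notin> T - {i} \<Longrightarrow> 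
      lorentz (N' (insert n (T - {i}))) (p j, 1) < 0"
  shows "facet_frame (convex hull (insert v P)) (Suc n) (stack_facets n T \<F>) (p(n := v)) N'"
proof
  note n = new_notin_facet[OF T]
  have im: "p(n := v) ` {..<Suc n} = insert v (p ` {..<n})"
    by (auto simp: lessThan_Suc)
  show hull': "convex hull (insert v P) = convex hull (p(n := v) ` {..<Suc n})"
    unfolding im hull by (rule hull_insert[symmetric])
  obtain t where t: "t \<in> T" using card3[OF T] by fastforce
  thus "stack_facets n T \<F> \<noteq> {}" unfolding stack_facets_def by blast
  fix x assume x: "\<And>S. S \<in> stack_facets n T \<F> \<Longrightarrow> lorentz (N' S) (x, 1) \<le> 0"
  show "x \<in> convex hull (insert v P)"
  proof (cases "lorentz (N T) (x, 1) \<le> 0")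
    case True
    have "x \<in> P"
    proof (rule covers)
      fix S assume S: "S \<in> \<F>"
      show "lorentz (N S) (x, 1) \<le> 0"
      proof (cases "S = T")
        case False
        thus ?thesis using x[of S] S old[of S] by (simp add: stack_facets_def)
      qed (use True in simp)
    qed
    thus ?thesis by (simp add: hull_inc)
  next
    case False
    \<comment> \<open>Each functional belongs to the face opposite its index; the base, opposite
      \<open>n\<close>, is the plane of \<open>T\<close> with reversed orientation.\<close>
    let ?M = "\<lambda>i. if i = n then - N T else N' (insert n (T - {i}))"
    have "x \<in> convex hull (p(n := v) ` insert n T)"
    proof (rule lorentz_simplex_hull[where M = ?M])
      show "finite (insert n T)" "card (insert n T) = 4"
        using finite_facet[OF T] card3[OF T] n by auto
    next
      fix i j assume "i \<in> insert n T" "j \<in> insert n T" "i \<noteq> j"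
      thus "lorentz (?M i) ((p(n := v)) j, 1) = 0"
        using new0[of i] new1[of i j] on_facet[OF T, of j] n by (auto simp: lorentz_minus_left)
    next
      fix i assume "i \<in> insert n T"
      thus "lorentz (?M i) ((p(n := v)) i, 1) < 0"
        using new2[of i i] beyond n subset[OF T] by (auto simp: lorentz_minus_left)
    next
      fix i assume "i \<in> insert n T"
      thus "lorentz (?M i) (x, 1) \<le> 0"
        using x[of "insert n (T - {i})"] False by (auto simp: lorentz_minus_left stack_facets_def)
    qed
    also have "\<dots> \<subseteq> convex hull (p(n := v) ` {..<Suc n})"
      using subset[OF T] by (intro hull_mono image_mono) auto
    finally show ?thesis unfolding hull' .
  qed
next
  fix S i assume S: "S \<in> stack_facets n T \<F>" "i \<in> S"
  show "\<exists>G\<in>stack_facets n T \<F>. G \<inter> S = S - {i}" using stack_facets_adjacent[OF T S] .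
  show "lorentz (N' S) ((p(n := v)) i, 1) = 0"
    using S(1)
  proof (cases rule: stack_facets_cases)
    case a: old
    thus ?thesis using new_notin_facet[OF a(1)] S(2) old[OF a(1)] on_facet by auto
  next
    case (new k)
    thus ?thesis using S(2) new0[of k] new1[of k i] by auto
  qed
next
  fix S assume S: "S \<in> stack_facets n T \<F>"
  show "S \<subseteq> {..<Suc n}" using S
    by (cases rule: stack_facets_cases) (use subset T in fastforce)+
  show "card S = 3" using S
  proof (cases rule: stack_facets_cases)
    case (new i)
    thus ?thesis using card3[OF T] finite_facet[OF T] new_notin_facet[OF T] by simp
  qed (use card3 in blast)
next
  fix S i assume S: "S \<in> stack_facets n T \<F>" "i < Suc n" "i \<notin> S"
  show "lorentz (N' S) ((p(n := v)) i, 1) < 0"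
    using S(1)
  proof (cases rule: stack_facets_cases)
    case a: old
    thus ?thesis using S(2,3) old[OF a(1)] beneath off_facet[OF a(1)] by auto
  next
    case (new k)
    thus ?thesis using S(2,3) new2[of k i] by auto
  qed
qed

lemma stack_frame_exists:
  assumes T: "T \<in> \<F>" and beyond: "lorentz (N T) (v, 1) > 0"
    and beneath: "\<And>S. S \<in> \<F> \<Longrightarrow> S \<noteq> T \<Longrightarrow> lorentz (N S) (v, 1) < 0"
  shows "\<exists>N'. facet_frame (convex hull (insert v P)) (Suc n) (stack_facets n T \<F>) (p(n := v)) N'"
proof -
  have "\<forall>i\<in>T. \<exists>G. G \<in> \<F> \<and> G \<inter> T = T - {i}" using adjacent[OF T] by blast
  then obtain G where G: "\<And>i. i \<in> T \<Longrightarrow> G i \<in> \<F>" "\<And>i. i \<in> T \<Longrightarrow> G i \<inter> T = T - {i}" by metis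
  \<comment> \<open>The plane through the new vertex and a ridge lies in the pencil of the two facet planes at that ridge.\<close>
  define K where "K i = lorentz (N T) (v, 1) *\<^sub>R N (G i) - lorentz (N (G i)) (v, 1) *\<^sub>R N T" for i
  \<comment> \<open>Containing \<open>n\<close> marks the new triangles; the description recovers
    the label of \<open>T\<close> that such a triangle omits.\<close>
  define N' where "N' S = (if n \<in> S then K (THE i. i \<in> T - S) else N S)" for S
  have K: "lorentz (K i) w = lorentz (N T) (v, 1) * lorentz (N (G i)) w
      - lorentz (N (G i)) (v, 1) * lorentz (N T) w" for i w
    by (simp add: K_def lorentz_diff_left lorentz_scaleR_left)
  note n = new_notin_facet[OF T]
  have new: "N' (insert n (T - {i})) = K i" if "i \<in> T" for i
  proof -
    have "(THE k. k \<in> T - insert n (T - {i})) = i" using that n by (intro the_equality) auto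
    thus ?thesis by (simp add: N'_def)
  qed
  have "facet_frame (convex hull (insert v P)) (Suc n) (stack_facets n T \<F>) (p(n := v)) N'"
  proof (rule stack_frame[OF T beyond beneath])
    fix S assume "S \<in> \<F>"
    thus "N' S = N S" using new_notin_facet by (simp add: N'_def)
  next
    fix i assume i: "i \<in> T"
    show "lorentz (N' (insert n (T - {i}))) (v, 1) = 0" using i by (simp add: new K)
    fix j
    { assume j: "j \<in> T - {i}"
      hence "j \<in> G i" using G(2)[OF i] by blast
      thus "lorentz (N' (insert n (T - {i}))) (p j, 1) = 0"
        using i j on_facet[OF T, of j] on_facet[OF G(1)[OF i], of j] by (simp add: new K) }
    assume j: "j < n" "j \<notin> T - {i}"
    have neg: "lorentz (N (G i)) (v, 1) < 0" using beneath[OF G(1)[OF i]] G(2)[OF i] i by blast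
    have le: "lorentz (N T) (v, 1) * lorentz (N (G i)) (p j, 1) \<le> 0"
        "lorentz (N (G i)) (v, 1) * lorentz (N T) (p j, 1) \<ge> 0"
      using beyond neg vertex_le[OF T j(1)] vertex_le[OF G(1)[OF i] j(1)]
      by (auto intro: mult_nonneg_nonpos mult_nonpos_nonpos)
    \<comment> \<open>Off the ridge, \<open>p j\<close> misses at least one of the two planes, so
      one of the two weak inequalities is strict.\<close>
    have "j \<notin> G i \<or> j \<notin> T" using j(2) G(2)[OF i] by blast
    hence "lorentz (N T) (v, 1) * lorentz (N (G i)) (p j, 1) < 0 \<or>
        lorentz (N (G i)) (v, 1) * lorentz (N T) (p j, 1) > 0"
      using beyond neg off_facet[OF T j(1)] off_facet[OF G(1)[OF i] j(1)]
      by (auto intro: mult_pos_neg mult_neg_neg)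
    with le show "lorentz (N' (insert n (T - {i}))) (p j, 1) < 0"
      unfolding new[OF i] K by linarith
  qed
  thus ?thesis by blast
qed

text \<open>The definition of a point beyond a facet allows any supporting inequality, while frames
  carry a fixed \<open>N T\<close>. Both planes are the affine hull of the facet, and a point
  \<open>d\<close> of \<open>P\<close> off the facet is strictly on the inner side of both.\<close>

lemma sign_transfer:
  assumes T: "T \<in> \<F>"
    and ab: "P \<subseteq> {x. a \<bullet> x \<le> b}" "convex hull (p ` T) = P \<inter> {x. a \<bullet> x = b}"
  shows "sgn (lorentz (N T) (v, 1)) = sgn (a \<bullet> v - b)"
proof -
  let ?F = "convex hull (p ` T)"
  let ?a = "fst (N T)" and ?b = "snd (N T)"
  obtain d where d: "d \<in> P" "d \<notin> ?F"
    using aff_dim_facet_less[OF T] facet_of_imp_subset[OF facet_of_facet[OF T]]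
    by (metis less_irrefl subsetI subset_antisym)
  have d': "a \<bullet> d < b" "?a \<bullet> d < ?b"
    using d ab facet_face[OF T] le_on_P[OF T d(1)] by (force simp: lorentz_point)+
  have "aff_dim ?F = 2" using facet_of_facet[OF T] aff_dim_P by (simp add: facet_of_def)
  have hyperplane: "affine hull ?F = {x. c \<bullet> x = e}" if "c \<bullet> d < e" "?F \<subseteq> {x. c \<bullet> x = e}" for c e
  proof (rule affine_dim_equal)
    have "?F \<noteq> {}" using \<open>aff_dim ?F = 2\<close> by auto
    thus "affine hull ?F \<noteq> {}" by simp
    show "affine hull ?F \<subseteq> {x. c \<bullet> x = e}"
      by (intro hull_minimal that(2) affine_hyperplane)
    hence "c \<noteq> 0" using \<open>affine hull ?F \<noteq> {}\<close> that by auto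
    thus "aff_dim (affine hull ?F) = aff_dim {x. c \<bullet> x = e}"
      using \<open>aff_dim ?F = 2\<close> by (simp only: aff_dim_affine_hull aff_dim_hyperplane) simp
  qed (auto simp: affine_hyperplane)
  have same: "{x. a \<bullet> x = b} = {x. ?a \<bullet> x = ?b}"
    using hyperplane[of a b] hyperplane[of ?a ?b] d' ab(2) facet_face[OF T] by (auto simp: lorentz_point)
  have transfer: "c' \<bullet> v < e'" if v: "c \<bullet> v < e" and d: "c \<bullet> d < e" "c' \<bullet> d < e'"
    and eq: "{x. c \<bullet> x = e} = {x. c' \<bullet> x = e'}" for c e c' e'
  proof (rule ccontr)
    assume ge: "\<not> c' \<bullet> v < e'"
    \<comment> \<open>The segment from \<open>d\<close> to \<open>v\<close> would cross the second
      plane at \<open>y\<close> while staying strictly on one side of the first, although the planes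
      coincide.\<close>
    define s where "s = (e' - c' \<bullet> d) / (c' \<bullet> v - c' \<bullet> d)"
    define y where "y = (1 - s) *\<^sub>R d + s *\<^sub>R v"
    have s: "0 \<le> s" "s \<le> 1" "s * (c' \<bullet> v - c' \<bullet> d) = e' - c' \<bullet> d"
      using d(2) ge by (auto simp: s_def field_simps)
    hence "c' \<bullet> y = e'" by (simp add: y_def inner_simps algebra_simps)
    hence "c \<bullet> y = e" using eq by blast
    moreover have "y \<in> {x. c \<bullet> x < e}"
      unfolding y_def using s v d(1) by (intro convexD[OF convex_halfspace_lt]) auto
    ultimately show False by simp
  qed
  have "a \<bullet> v < b \<longleftrightarrow> ?a \<bullet> v < ?b"
    using transfer[of a b ?a ?b] transfer[of ?a ?b a b] d' same by blast
  moreover have "a \<bullet> v = b \<longleftrightarrow> ?a \<bullet> v = ?b" using same by blast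
  ultimately show ?thesis by (auto simp: lorentz_point sgn_if)
qed

lemma beyond_facet_signs:
  assumes "beyond_facet P F v"
  obtains T where "T \<in> \<F>" "lorentz (N T) (v, 1) > 0"
    "\<And>S. S \<in> \<F> \<Longrightarrow> S \<noteq> T \<Longrightarrow> lorentz (N S) (v, 1) < 0"
proof -
  have F: "F facet_of P" "beyond_halfspace P F v"
    "\<And>G. G facet_of P \<Longrightarrow> G \<noteq> F \<Longrightarrow> beneath_halfspace P G v"
    using assms by (auto simp: beyond_facet_def)
  obtain T where T: "T \<in> \<F>" "F = convex hull (p ` T)" using facet_ofE[OF F(1)] by blast
  obtain a b where "P \<subseteq> {x. a \<bullet> x \<le> b}" "F = P \<inter> {x. a \<bullet> x = b}" "a \<bullet> v > b"
    using F(2) by (auto simp: beyond_halfspace_def)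
  hence "lorentz (N T) (v, 1) > 0" using sign_transfer[OF T(1), of a b v] T(2) by (simp add: sgn_if split: if_splits)
  moreover have "lorentz (N S) (v, 1) < 0" if S: "S \<in> \<F>" "S \<noteq> T" for S
  proof -
    have "convex hull (p ` S) \<noteq> F"
      using face_vertex_sets_realized(2)[OF subset_face_vertex_sets] S T by (metis subset_refl)
    then obtain a b where "P \<subseteq> {x. a \<bullet> x \<le> b}" "convex hull (p ` S) = P \<inter> {x. a \<bullet> x = b}" "a \<bullet> v < b"
      using F(3)[OF facet_of_facet[OF S(1)]] by (auto simp: beneath_halfspace_def)
    thus ?thesis using sign_transfer[OF S(1), of a b v] by (simp add: sgn_if split: if_splits)
  qed
  ultimately show ?thesis using T(1) that by blast
qed

end

section \<open>Frames of tetrahedra\<close>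

abbreviation tetrahedron_facets :: "nat set set" where
  "tetrahedron_facets \<equiv> (\<lambda>l. {..<4} - {l}) ` {..<4}"

lemma tetrahedron_frame:
  assumes zero: "\<And>l j. l < 4 \<Longrightarrow> j < 4 \<Longrightarrow> j \<noteq> l \<Longrightarrow> lorentz (N ({..<4} - {l})) (p j, 1) = 0"
    and neg: "\<And>l. l < 4 \<Longrightarrow> lorentz (N ({..<4} - {l})) (p l, 1) < 0"
  shows "facet_frame (convex hull (p ` {..<4})) 4 tetrahedron_facets p N"
proof
  fix x assume "\<And>T. T \<in> tetrahedron_facets \<Longrightarrow> lorentz (N T) (x, 1) \<le> 0"
  thus "x \<in> convex hull (p ` {..<4})"
    using zero neg by (intro lorentz_simplex_hull[where M = "\<lambda>l. N ({..<4} - {l})"]) auto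
next
  fix T i assume T: "T \<in> tetrahedron_facets" "i \<in> T"
  then obtain l where l: "l < 4" "T = {..<4} - {l}" by blast
  show "\<exists>G\<in>tetrahedron_facets. G \<inter> T = T - {i}"
    using T(2) l by (intro bexI[of _ "{..<4} - {i}"]) auto
  show "lorentz (N T) (p i, 1) = 0" using T(2) l zero by auto
next
  fix T i assume "T \<in> tetrahedron_facets" "i < (4::nat)" "i \<notin> T"
  thus "lorentz (N T) (p i, 1) < 0" using neg by auto
qed (auto simp: lessThan_empty_iff)

lemma simplex_frame_exists:
  assumes "3 simplex P"
  shows "\<exists>p N. facet_frame P 4 tetrahedron_facets p N"
proof -
  obtain C where C: "finite C" "\<not> affine_dependent C" "int (card C) = 3 + 1" "P = convex hull C"
    using assms by (auto simp: simplex)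
  have "card C = 4" using C(3) by simp
  then obtain p where p: "bij_betw p {..<4::nat} C"
    using finite_same_card_bij[of "{..<4::nat}" C] C(1) by auto
  have inj: "inj_on p {..<4}" and im: "p ` {..<4} = C" using p by (auto simp: bij_betw_def)
  have "\<exists>M. (\<forall>j<4. j \<noteq> l \<longrightarrow> lorentz M (p j, 1) = 0) \<and> lorentz M (p l, 1) < 0" if l: "l < 4" for l
  proof -
    let ?D = "C - {p l}"
    have pl: "p l \<in> C" using l im by blast
    have "\<not> affine_dependent ?D" using C(2) affine_independent_subset by blast
    hence "aff_dim ?D = 2"
      using aff_dim_affine_independent[of ?D] \<open>card C = 4\<close> pl C(1) by simp
    then obtain a b where ab: "affine hull ?D = {x. a \<bullet> x = b}"
      using aff_dim_eq_hyperplane[of ?D] by auto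
    have "p l \<notin> affine hull ?D" using C(2) pl unfolding affine_dependent_def by blast
    hence ne: "a \<bullet> p l \<noteq> b" using ab by blast
    have "a \<bullet> p j = b" if "j < 4" "j \<noteq> l" for j
    proof -
      have "p j \<in> ?D" using that l inj im by (auto simp: inj_on_eq_iff)
      thus ?thesis using ab hull_inc[of "p j" ?D affine] by blast
    qed
    hence "(\<forall>j<4. j \<noteq> l \<longrightarrow> lorentz (c *\<^sub>R (a, b)) (p j, 1) = 0)" for c
      by (simp add: lorentz_def)
    \<comment> \<open>The sign factor orients the plane through the other three vertices so that
      \<open>p l\<close> is on its negative side.\<close>
    moreover have "lorentz (sgn (b - a \<bullet> p l) *\<^sub>R (a, b)) (p l, 1) < 0"
      using ne by (auto simp: lorentz_def sgn_if)
    ultimately show ?thesis by blast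
  qed
  then obtain M where M: "\<And>l j. l < 4 \<Longrightarrow> j < 4 \<Longrightarrow> j \<noteq> l \<Longrightarrow> lorentz (M l) (p j, 1) = 0"
      "\<And>l. l < 4 \<Longrightarrow> lorentz (M l) (p l, 1) < 0" by metis
  define N where "N T = M (THE l. l \<in> {..<4} - T)" for T
  have N: "N ({..<4} - {l}) = M l" if "l < 4" for l
  proof -
    have "(THE k. k \<in> {..<4} - ({..<4} - {l})) = l" using that by (intro the_equality) auto
    thus ?thesis by (simp add: N_def)
  qed
  have "facet_frame P 4 tetrahedron_facets p N"
    unfolding C(4) im[symmetric] using M N by (intro tetrahedron_frame) auto
  thus ?thesis by blast
qed

section \<open>Rational configurations with tangent edges\<close>

definition dehomogenize :: "(real^3) \<times> real \<Rightarrow> real^3" where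
  "dehomogenize u = fst u /\<^sub>R snd u"

lemma lorentz_dehomogenize:
  assumes "snd u > 0" shows "lorentz w u = snd u * lorentz w (dehomogenize u, 1)"
  using assms by (simp add: lorentz_def dehomogenize_def algebra_simps)

definition rational_vector :: "(real^3) \<times> real \<Rightarrow> bool" where
  "rational_vector u \<longleftrightarrow> (\<forall>k. fst u $ k \<in> \<rat>) \<and> snd u \<in> \<rat>"

lemma rational_vector_add: "rational_vector u \<Longrightarrow> rational_vector v \<Longrightarrow> rational_vector (u + v)"
  by (simp add: rational_vector_def)

lemma rational_vector_sum: "(\<And>i. i \<in> A \<Longrightarrow> rational_vector (f i)) \<Longrightarrow> rational_vector (sum f A)"
  by (induction A rule: infinite_finite_induct) (auto simp: rational_vector_def)

text \<open>These are the invariants of stacking. The vector \<open>U i\<close> stands for the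
  circle along which the tangent cone from the vertex touches the sphere; for square 2, the product
  \<open>- 2\<close> means that two such circles touch externally. By \<open>dual_height\<close>,
  the origin satisfies every facet inequality.\<close>

locale tangent_packing =
  fixes n :: nat and \<F> :: "nat set set" and U :: "nat \<Rightarrow> (real^3) \<times> real"
    and N :: "nat set \<Rightarrow> (real^3) \<times> real"
  assumes frame: "facet_frame (convex hull ((\<lambda>i. dehomogenize (U i)) ` {..<n})) n \<F> (\<lambda>i. dehomogenize (U i)) N"
    and self: "i < n \<Longrightarrow> lorentz (U i) (U i) = 2"
    and height: "i < n \<Longrightarrow> snd (U i) > 0"
    and separated: "i < n \<Longrightarrow> j < n \<Longrightarrow> i \<noteq> j \<Longrightarrow> lorentz (U i) (U j) < 0"
    and tangent: "T \<in> \<F> \<Longrightarrow> i \<in> T \<Longrightarrow> j \<in> T \<Longrightarrow> i \<noteq> j \<Longrightarrow> lorentz (U i) (U j) = - 2"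
    and dual_self: "T \<in> \<F> \<Longrightarrow> lorentz (N T) (N T) = 8"
    and dual_height: "T \<in> \<F> \<Longrightarrow> snd (N T) \<ge> 0"
    and dual_separated: "S \<in> \<F> \<Longrightarrow> T \<in> \<F> \<Longrightarrow> S \<noteq> T \<Longrightarrow> lorentz (N S) (N T) \<le> 0"
    and rational: "i < n \<Longrightarrow> rational_vector (U i)"
    and dual_rational: "T \<in> \<F> \<Longrightarrow> rational_vector (N T)"
begin

sublocale facet_frame "convex hull ((\<lambda>i. dehomogenize (U i)) ` {..<n})" n \<F> "\<lambda>i. dehomogenize (U i)" N
  by (rule frame)

lemma dual_on:
  assumes "T \<in> \<F>" "i \<in> T" shows "lorentz (N T) (U i) = 0"
proof -
  have "i < n" using subset[OF assms(1)] assms(2) by blast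
  thus ?thesis using lorentz_dehomogenize[OF height, of i "N T"] on_facet[OF assms] by simp
qed

lemma dual_off: "T \<in> \<F> \<Longrightarrow> i < n \<Longrightarrow> i \<notin> T \<Longrightarrow> lorentz (N T) (U i) < 0"
  using lorentz_dehomogenize[OF height, of i "N T"] off_facet[of T i] height[of i] by (simp add: mult_pos_neg)

lemma dual_le: "T \<in> \<F> \<Longrightarrow> i < n \<Longrightarrow> lorentz (N T) (U i) \<le> 0"
  using dual_on dual_off by (cases "i \<in> T") (auto intro: less_imp_le)

text \<open>The Gram matrix of the vectors of a facet has entries 2 on and \<open>- 2\<close> off
  the diagonal, that is 4 times the identity minus the all-2 matrix. All products during a stacking
  reduce to such cardinality counts.\<close>

lemma lorentz_facet_sum:
  assumes T: "T \<in> \<F>" and "A \<subseteq> T" "i \<in> T"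
  shows "lorentz (U i) (\<Sum>j\<in>A. U j) = (if i \<in> A then 4 else 0) - 2 * real (card A)"
proof -
  have fin: "finite A" using assms finite_facet finite_subset by blast
  have "lorentz (U i) (\<Sum>j\<in>A. U j) = (\<Sum>j\<in>A. (if j = i then 4 else 0) - 2)"
    unfolding lorentz_sum_right
    using assms self[of i] subset[OF T] tangent[OF T] by (intro sum.cong) auto
  thus ?thesis using fin by (simp add: sum_subtractf)
qed

lemma lorentz_facet_sums:
  assumes T: "T \<in> \<F>" and AB: "A \<subseteq> T" "B \<subseteq> T"
  shows "lorentz (\<Sum>i\<in>A. U i) (\<Sum>j\<in>B. U j) = 4 * real (card (A \<inter> B)) - 2 * real (card A) * real (card B)"
proof -
  have fin: "finite A" using assms finite_facet finite_subset by blast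
  have "lorentz (\<Sum>i\<in>A. U i) (\<Sum>j\<in>B. U j) = (\<Sum>i\<in>A. (if i \<in> B then 4 else 0) - 2 * real (card B))"
    unfolding lorentz_sum_left
    using lorentz_facet_sum[OF T AB(2)] AB(1) by (intro sum.cong) auto
  also have "\<dots> = 4 * real (card (A \<inter> B)) - 2 * real (card A) * real (card B)"
    using fin by (simp add: sum_subtractf flip: sum.inter_restrict)
  finally show ?thesis .
qed

lemma dual_facet_sum: "T \<in> \<F> \<Longrightarrow> A \<subseteq> T \<Longrightarrow> lorentz (N T) (\<Sum>j\<in>A. U j) = 0"
  unfolding lorentz_sum_right using dual_on by (intro sum.neutral) blast

lemma dual_sum_le: "S \<in> \<F> \<Longrightarrow> A \<subseteq> {..<n} \<Longrightarrow> lorentz (N S) (\<Sum>j\<in>A. U j) \<le> 0"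
  unfolding lorentz_sum_right using dual_le by (intro sum_nonpos) auto

lemma stack_packing:
  assumes T: "T \<in> \<F>"
  shows "\<exists>U' N'. tangent_packing (Suc n) (stack_facets n T \<F>) U' N'"
proof -
  define e where "e = N T + (\<Sum>i\<in>T. U i)"
  define U' where "U' = U(n := e)"
  define M where "M A = N T + 2 *\<^sub>R (\<Sum>i\<in>A. U i)" for A
  define N' where "N' S = (if n \<in> S then M (S - {n}) else N S)" for S
  note n = new_notin_facet[OF T]
  have fT: "finite T" and cT: "card T = 3" and sT: "T \<subseteq> {..<n}"
    using finite_facet card3 subset T by auto
  have cTi: "card (T - {i}) = 2" if "i \<in> T" for i using that cT fT by simp
  have new: "N' (insert n (T - {i})) = M (T - {i})" for i
    using n by (simp add: N'_def)
  have old: "N' S = N S" if "S \<in> \<F>" for S using new_notin_facet[OF that] by (simp add: N'_def)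
  have e_right: "lorentz w e = lorentz w (N T) + lorentz w (\<Sum>i\<in>T. U i)" for w
    by (simp add: e_def lorentz_add_right)
  have M_left: "lorentz (M A) w = lorentz (N T) w + 2 * lorentz (\<Sum>i\<in>A. U i) w" for A w
    by (simp add: M_def lorentz_add_left lorentz_scaleR_left)
  have M_right: "lorentz w (M A) = lorentz w (N T) + 2 * lorentz w (\<Sum>i\<in>A. U i)" for A w
    by (simp add: M_def lorentz_add_right lorentz_scaleR_right)
  \<comment> \<open>The value is 0 + 4 - 6.\<close>
  have e_vertex: "lorentz (U i) e = - 2" if "i \<in> T" for i
    unfolding e_right
    using dual_on[OF T that] lorentz_facet_sum[OF T subset_refl that] cT that
      lorentz_commute[of "U i" "N T"] by simp
  \<comment> \<open>The normal contributes 8, the mixed terms 0, and the sum over \<open>T\<close>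
    contributes 12 - 18.\<close>
  have e_self: "lorentz e e = 2"
    using dual_self[OF T] dual_facet_sum[OF T subset_refl] lorentz_facet_sums[OF T subset_refl subset_refl] cT
    unfolding e_def by (simp add: lorentz_add_left lorentz_add_right lorentz_commute)
  have e_dual: "lorentz (N T) e = 8"
    using dual_self[OF T] dual_facet_sum[OF T subset_refl] by (simp add: e_right)
  have sum_neg: "lorentz w (\<Sum>i\<in>A. U i) < 0"
    if A: "A \<subseteq> {..<n}" "k \<in> A" "lorentz w (U k) < 0" "\<And>i. i \<in> A \<Longrightarrow> lorentz w (U i) \<le> 0" for w A k
  proof -
    have "finite A" using A(1) finite_subset by blast
    hence "(\<Sum>i\<in>A. lorentz w (U i)) < (\<Sum>i\<in>A. 0)"
      using A by (intro sum_strict_mono_ex1) auto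
    thus ?thesis by (simp add: lorentz_sum_right)
  qed
  have e_separated: "lorentz (U j) e < 0" if "j < n" for j
  proof (cases "j \<in> T")
    case False
    obtain k where "k \<in> T" using cT by fastforce
    hence "lorentz (U j) (\<Sum>i\<in>T. U i) < 0"
      using separated[OF that] False sT by (intro sum_neg[of T k]) (auto intro: less_imp_le)
    thus ?thesis
      using dual_off[OF T that False] lorentz_commute[of "U j" "N T"] by (simp add: e_right)
  qed (simp add: e_vertex)
  have e_beneath: "lorentz (N S) e < 0" if S: "S \<in> \<F>" "S \<noteq> T" for S
  proof -
    have "\<not> T \<subseteq> S"
      using S card3[OF S(1)] cT card_subset_eq[OF finite_facet[OF S(1)]] by metis
    then obtain k where k: "k \<in> T" "k \<notin> S" by blast
    have "lorentz (N S) (\<Sum>i\<in>T. U i) < 0"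
      using k sT dual_off[OF S(1)] dual_le[OF S(1)] by (intro sum_neg[of T k]) auto
    thus ?thesis using dual_separated[OF S(1) T S(2)] by (simp add: e_right)
  qed
  have sum_height: "0 \<le> snd (\<Sum>i\<in>A. U i)" if "A \<subseteq> {..<n}" for A
    unfolding snd_sum using that height by (intro sum_nonneg) (auto intro: less_imp_le)
  have "0 < snd (\<Sum>i\<in>T. U i)"
    unfolding snd_sum using height sT fT cT by (intro sum_pos) auto
  hence e_height: "snd e > 0" using dual_height[OF T] by (simp add: e_def)
  \<comment> \<open>The normal contributes 8, which cancels twice the product - 4 of the ridge sum
    with \<open>e\<close>.\<close>
  have M_e: "lorentz (M (T - {i})) e = 0" if "i \<in> T" for i
  proof -
    have inter: "(T - {i}) \<inter> T = T - {i}" by blast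
    have "lorentz (\<Sum>j\<in>T - {i}. U j) (\<Sum>j\<in>T. U j) = - 4"
      using lorentz_facet_sums[OF T Diff_subset subset_refl, of "{i}"]
      unfolding inter cTi[OF that] cT by simp
    moreover have "lorentz (\<Sum>j\<in>T - {i}. U j) (N T) = 0"
      using dual_facet_sum[OF T, of "T - {i}"] by (simp add: lorentz_commute)
    ultimately have "lorentz (\<Sum>j\<in>T - {i}. U j) e = - 4" by (simp add: e_right)
    thus ?thesis using e_dual by (simp add: M_left)
  qed
  have M_on: "lorentz (M (T - {i})) (U j) = 0" if "i \<in> T" "j \<in> T - {i}" for i j
    unfolding M_left lorentz_commute[of "sum U (T - {i})"]
    using lorentz_facet_sum[OF T, of "T - {i}" j] that cTi[OF that(1)] dual_on[OF T, of j] by simp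
  have M_off: "lorentz (M (T - {i})) (U j) < 0" if i: "i \<in> T" and j: "j < n" "j \<notin> T - {i}" for i j
  proof -
    have "T - {i} \<noteq> {}" using cTi[OF i] by (metis card.empty zero_neq_numeral)
    then obtain k where k: "k \<in> T - {i}" by blast
    have "lorentz (U j) (\<Sum>l\<in>T - {i}. U l) < 0"
      using separated[OF j(1)] j k sT by (intro sum_neg[of "T - {i}" k]) (auto intro: less_imp_le)
    thus ?thesis
      unfolding M_left lorentz_commute[of "sum U (T - {i})"] using dual_le[OF T j(1)] by simp
  qed
  \<comment> \<open>The value is 8 + 4 * (4 * c - 8), where c, the number of common old labels, is 2
    or 1.\<close>
  have MM: "lorentz (M (T - {i})) (M (T - {j})) = (if i = j then 8 else - 8)" if "i \<in> T" "j \<in> T" for i j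
  proof -
    have inter: "(T - {i}) \<inter> (T - {j}) = T - {i} - {j}" by blast
    have "card (T - {i} - {j}) = (if i = j then 2 else 1)"
      using cT fT that by auto
    hence "lorentz (\<Sum>l\<in>T - {i}. U l) (\<Sum>l\<in>T - {j}. U l) = (if i = j then 0 else - 4)"
      using lorentz_facet_sums[OF T Diff_subset Diff_subset, of "{i}" "{j}"]
      unfolding inter cTi[OF that(1)] cTi[OF that(2)] by simp
    moreover have "lorentz (\<Sum>l\<in>T - {i}. U l) (N T) = 0" "lorentz (N T) (\<Sum>l\<in>T - {j}. U l) = 0"
      using dual_facet_sum[OF T] lorentz_commute by (metis Diff_subset)+
    ultimately show ?thesis using dual_self[OF T] by (auto simp: M_left M_right)
  qed
  have M_dual: "lorentz (N S) (M A) \<le> 0" if S: "S \<in> \<F>" "S \<noteq> T" and A: "A \<subseteq> T" for S A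
    using dual_separated[OF S(1) T S(2)] dual_sum_le[OF S(1) subset_trans[OF A sT]]
    by (simp add: M_right)
  define v where "v = dehomogenize e"
  have v: "lorentz w e = snd e * lorentz w (v, 1)" for w
    unfolding v_def by (rule lorentz_dehomogenize[OF e_height])
  \<comment> \<open>As \<open>snd e\<close> is positive, products with \<open>e\<close> and
    evaluations at the point \<open>v\<close> have the same sign.\<close>
  have pos: "snd e * x > 0 \<longleftrightarrow> x > 0" "snd e * x < 0 \<longleftrightarrow> x < 0" "snd e * x = 0 \<longleftrightarrow> x = 0" for x
    using e_height by (auto simp: zero_less_mult_iff mult_less_0_iff)
  have M_p: "lorentz w (U j) = snd (U j) * lorentz w (dehomogenize (U j), 1)" "snd (U j) > 0" if "j < n" for w j
    using lorentz_dehomogenize[OF height[OF that]] height[OF that] by auto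
  have points: "(\<lambda>i. dehomogenize (U i))(n := v) = (\<lambda>i. dehomogenize (U' i))"
    by (auto simp: U'_def v_def)
  have "facet_frame (convex hull (insert v (convex hull ((\<lambda>i. dehomogenize (U i)) ` {..<n}))))
      (Suc n) (stack_facets n T \<F>) (\<lambda>i. dehomogenize (U' i)) N'" (is "facet_frame ?Q _ _ _ _")
    unfolding points[symmetric]
  proof (rule stack_frame[OF T])
    show "lorentz (N T) (v, 1) > 0" using e_dual unfolding v by (metis pos(1) zero_less_numeral)
  next
    fix S assume "S \<in> \<F>" "S \<noteq> T"
    thus "lorentz (N S) (v, 1) < 0" using e_beneath unfolding v pos by blast
  next
    fix i assume "i \<in> T"
    thus "lorentz (N' (insert n (T - {i}))) (v, 1) = 0" using M_e unfolding v pos new by blast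
  next
    fix i j assume ij: "i \<in> T" "j \<in> T - {i}"
    hence "j < n" using sT by blast
    thus "lorentz (N' (insert n (T - {i}))) (dehomogenize (U j), 1) = 0"
      using M_on[OF ij] M_p[of j] by (simp add: new)
  next
    fix i j assume ij: "i \<in> T" "j < n" "j \<notin> T - {i}"
    thus "lorentz (N' (insert n (T - {i}))) (dehomogenize (U j), 1) < 0"
      using M_off[OF ij] M_p[of j] by (simp add: new mult_less_0_iff)
  qed (simp add: old)
  \<comment> \<open>The \<open>hull\<close> property of the new frame itself flattens the nested
    hull into the form that \<open>tangent_packing\<close> requires.\<close>
  moreover from facet_frame.hull[OF this]
  have "?Q = convex hull ((\<lambda>i. dehomogenize (U' i)) ` {..<Suc n})" .
  ultimately have fr: "facet_frame (convex hull ((\<lambda>i. dehomogenize (U' i)) ` {..<Suc n}))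
      (Suc n) (stack_facets n T \<F>) (\<lambda>i. dehomogenize (U' i)) N'" by simp
  have rT: "rational_vector (\<Sum>i\<in>A. U i)" if "A \<subseteq> T" for A
    using that sT rational by (intro rational_vector_sum) auto
  have re: "rational_vector e"
    unfolding e_def using dual_rational[OF T] rT by (intro rational_vector_add) auto
  \<comment> \<open>Writing the double as a sum reduces rationality to closure under
    addition.\<close>
  have rM: "rational_vector (M A)" if "A \<subseteq> T" for A
    unfolding M_def scaleR_2 using dual_rational[OF T] rT[OF that] by (intro rational_vector_add)
  have "tangent_packing (Suc n) (stack_facets n T \<F>) U' N'"
  proof (rule tangent_packing.intro)
    fix i assume "i < Suc n"
    thus "lorentz (U' i) (U' i) = 2" "snd (U' i) > 0" "rational_vector (U' i)"
      using self height rational e_self e_height re by (auto simp: U'_def less_Suc_eq)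
  next
    fix i j assume "i < Suc n" "j < Suc n" "i \<noteq> j"
    thus "lorentz (U' i) (U' j) < 0"
      using separated e_separated by (auto simp: U'_def less_Suc_eq lorentz_commute)
  next
    fix S i j assume S: "S \<in> stack_facets n T \<F>" "i \<in> S" "j \<in> S" "i \<noteq> j"
    show "lorentz (U' i) (U' j) = - 2" using S(1)
    proof (cases rule: stack_facets_cases)
      case a: old
      thus ?thesis using S tangent[OF a(1)] new_notin_facet[OF a(1)] by (auto simp: U'_def)
    next
      case (new k)
      thus ?thesis using S(2-) tangent[OF T] e_vertex n by (auto simp: U'_def lorentz_commute)
    qed
  next
    fix S assume S: "S \<in> stack_facets n T \<F>"
    show "lorentz (N' S) (N' S) = 8" using S
      by (cases rule: stack_facets_cases) (auto simp: old new dual_self MM)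
    show "snd (N' S) \<ge> 0" using S
    proof (cases rule: stack_facets_cases)
      case a: (new i)
      have "0 \<le> snd (\<Sum>j\<in>T - {i}. U j)" using sT by (intro sum_height) blast
      thus ?thesis using dual_height[OF T] by (simp add: a new M_def)
    qed (simp add: old dual_height)
    show "rational_vector (N' S)" using S
      by (cases rule: stack_facets_cases) (auto simp: old new dual_rational rM)
    fix R assume R: "R \<in> stack_facets n T \<F>" "S \<noteq> R"
    show "lorentz (N' S) (N' R) \<le> 0"
      using S
    proof (cases rule: stack_facets_cases)
      case a: old
      show ?thesis using R(1)
      proof (cases rule: stack_facets_cases)
        case b: old
        thus ?thesis using a R(2) dual_separated by (simp add: old)
      next
        case b: (new i)
        thus ?thesis using a M_dual[of S "T - {i}"] by (auto simp: old new)
      qed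
    next
      case a: (new i)
      show ?thesis using R(1)
      proof (cases rule: stack_facets_cases)
        case b: old
        thus ?thesis using a M_dual[of R "T - {i}"] by (auto simp: old new lorentz_commute)
      next
        case b: (new j)
        hence "i \<noteq> j" using a R(2) by blast
        thus ?thesis using a b by (simp add: new MM)
      qed
    qed
  qed (rule fr)
  thus ?thesis by blast
qed

end

section \<open>The regular tetrahedron as initial packing\<close>

definition regular_vertex :: "nat \<Rightarrow> real^3" where
  "regular_vertex i = (if i = 0 then vector [1, 1, 1] else if i = 1 then vector [1, -1, -1]
     else if i = 2 then vector [-1, 1, -1] else vector [-1, -1, 1])"

text \<open>With time component 1, these values become the required Lorentz products 2 and
  \<open>- 2\<close>.\<close>

lemma regular_vertex_inner:
  assumes "i < 4" "j < 4"
  shows "regular_vertex i \<bullet> regular_vertex j = (if i = j then 3 else - 1)"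
proof -
  have "i \<in> {0, 1, 2, 3}" "j \<in> {0, 1, 2, 3}" using assms by auto
  thus ?thesis by (auto simp: regular_vertex_def inner_vec_def sum_3)
qed

lemma regular_vertex_rational: "regular_vertex i $ k \<in> \<rat>"
proof -
  have "k \<in> {1, 2, 3}" using exhaust_3[of k] by auto
  thus ?thesis by (auto simp: regular_vertex_def)
qed

lemma regular_packing: "\<exists>U N. tangent_packing 4 tetrahedron_facets U N"
proof -
  define U :: "nat \<Rightarrow> (real^3) \<times> real" where "U i = (regular_vertex i, 1)" for i
  \<comment> \<open>The facet opposite a vertex has the negative of that vertex as outer normal; the
    factor 2 makes the Lorentz square 12 - 4 = 8.\<close>
  define N :: "nat set \<Rightarrow> (real^3) \<times> real" where
    "N T = (- 2 *\<^sub>R regular_vertex (THE l. l \<in> {..<4} - T), 2)" for T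
  have N: "N ({..<4} - {l}) = (- 2 *\<^sub>R regular_vertex l, 2)" if "l < 4" for l
  proof -
    have "(THE k. k \<in> {..<4} - ({..<4} - {l})) = l" using that by (intro the_equality) auto
    thus ?thesis by (simp add: N_def)
  qed
  have p: "(\<lambda>i. dehomogenize (U i)) = regular_vertex" by (simp add: U_def dehomogenize_def)
  have fr: "facet_frame (convex hull ((\<lambda>i. dehomogenize (U i)) ` {..<4})) 4 tetrahedron_facets
      (\<lambda>i. dehomogenize (U i)) N"
    unfolding p by (rule tetrahedron_frame) (simp_all add: N lorentz_def regular_vertex_inner)
  have "tangent_packing 4 tetrahedron_facets U N"
  proof (rule tangent_packing.intro)
    fix T i j assume T: "T \<in> tetrahedron_facets" "i \<in> T" "j \<in> T" "i \<noteq> (j::nat)"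
    thus "lorentz (U i) (U j) = - 2" by (auto simp: U_def lorentz_def regular_vertex_inner)
  next
    fix T assume "T \<in> tetrahedron_facets"
    then obtain l where l: "l < 4" "T = {..<4} - {l}" by blast
    thus "lorentz (N T) (N T) = 8" "snd (N T) \<ge> 0" by (simp_all add: N lorentz_def regular_vertex_inner)
    show "rational_vector (N T)"
      using l by (auto simp: N rational_vector_def intro!: Rats_mult regular_vertex_rational)
    fix S assume "S \<in> tetrahedron_facets" "S \<noteq> T"
    then obtain k where "k < 4" "S = {..<4} - {k}" "k \<noteq> l" using l by blast
    thus "lorentz (N S) (N T) \<le> 0" using l by (simp add: N lorentz_def regular_vertex_inner)
  next
    fix i :: nat assume "i < 4"
    thus "rational_vector (U i)" by (simp add: U_def rational_vector_def regular_vertex_rational)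
  qed (rule fr, simp_all add: U_def lorentz_def regular_vertex_inner)
  thus ?thesis by blast
qed

section \<open>Tangent edges and rational vertices of a packing\<close>

context tangent_packing
begin

abbreviation Q :: "(real^3) set" where
  "Q \<equiv> convex hull ((\<lambda>i. dehomogenize (U i)) ` {..<n})"

text \<open>An edge has exactly two labels, and they lie in a common facet, so its end vectors have
  product \<open>- 2\<close>. The sphere then has a double point on the line of the edge.\<close>

lemma edge_tangent:
  assumes e: "e edge_of Q" shows "tangent_to_unit_sphere e"
proof -
  let ?p = "\<lambda>i. dehomogenize (U i)"
  let ?A = "vertex_set n ?p e"
  have face: "e face_of Q" and dim: "aff_dim e = 1" using e by (auto simp: edge_of_def)
  have eA: "e = convex hull (?p ` ?A)" by (rule face_eq_hull[OF face])
  have "?A \<noteq> {..<n}" using eA dim aff_dim_P by auto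
  then obtain T where T: "T \<in> \<F>" "?A \<subseteq> T" using proper_face_in_facet vertex_set_face[OF face] by blast
  have fA: "finite ?A" using T finite_facet finite_subset by blast
  \<comment> \<open>Three labels inside a facet would span dimension 2, and a single one would span
    only a point.\<close>
  have "card ?A \<le> 2" using aff_dim_face_lower[OF T] dim eA by simp
  moreover have "card ?A \<ge> 2"
  proof -
    have "aff_dim (?p ` ?A) \<le> int (card (?p ` ?A)) - 1" using fA by (intro aff_dim_le_card) auto
    moreover have "card (?p ` ?A) \<le> card ?A" using fA by (rule card_image_le)
    moreover have "aff_dim (?p ` ?A) = 1" using dim eA by (metis aff_dim_convex_hull)
    ultimately show ?thesis by simp
  qed
  ultimately obtain i j where ij: "?A = {i, j}" "i \<noteq> j" by (metis card_2_iff le_antisym)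
  have ijT: "i \<in> T" "j \<in> T" and ijn: "i < n" "j < n" using ij T subset[OF T(1)] by auto
  define s t where "s = snd (U i)" and "t = snd (U j)"
  have st: "s > 0" "t > 0" using height ijn by (auto simp: s_def t_def)
  have e2: "e = convex hull {?p i, ?p j}" using eA ij by simp
  have Ui: "fst (U i) = s *\<^sub>R ?p i" "fst (U j) = t *\<^sub>R ?p j"
    using st by (simp_all add: s_def t_def dehomogenize_def)
  have inner: "s\<^sup>2 * (?p i \<bullet> ?p i - 1) = 2" "t\<^sup>2 * (?p j \<bullet> ?p j - 1) = 2"
    "s * t * (?p i \<bullet> ?p j - 1) = - 2"
    using self[OF ijn(1)] self[OF ijn(2)] tangent[OF T(1) ijT ij(2)]
    by (simp_all add: lorentz_def Ui power2_eq_square algebra_simps flip: s_def t_def)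
  \<comment> \<open>On the line through the two vertices, the sphere's equation is the square of a linear form.\<close>
  have line: "norm (a *\<^sub>R ?p i + b *\<^sub>R ?p j) = 1 \<longleftrightarrow> a * t = b * s" if ab: "a + b = 1" for a b
  proof -
    have "(norm (a *\<^sub>R ?p i + b *\<^sub>R ?p j))\<^sup>2 - (a + b)\<^sup>2
        = a\<^sup>2 * (?p i \<bullet> ?p i - 1) + b\<^sup>2 * (?p j \<bullet> ?p j - 1) + 2 * (a * b) * (?p i \<bullet> ?p j - 1)"
      unfolding power2_norm_eq_inner
      by (simp add: inner_simps inner_commute[of "?p j" "?p i"] power2_eq_square algebra_simps)
    hence "(s * t)\<^sup>2 * ((norm (a *\<^sub>R ?p i + b *\<^sub>R ?p j))\<^sup>2 - (a + b)\<^sup>2)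
        = (a * t)\<^sup>2 * (s\<^sup>2 * (?p i \<bullet> ?p i - 1)) + (b * s)\<^sup>2 * (t\<^sup>2 * (?p j \<bullet> ?p j - 1))
          + 2 * (a * t) * (b * s) * (s * t * (?p i \<bullet> ?p j - 1))"
      by (simp add: power2_eq_square algebra_simps)
    also have "\<dots> = 2 * (a * t - b * s)\<^sup>2"
      unfolding inner by (simp add: power2_eq_square algebra_simps)
    finally have *: "(s * t)\<^sup>2 * ((norm (a *\<^sub>R ?p i + b *\<^sub>R ?p j))\<^sup>2 - 1) = 2 * (a * t - b * s)\<^sup>2"
      by (simp add: ab)
    have "norm (a *\<^sub>R ?p i + b *\<^sub>R ?p j) = 1 \<longleftrightarrow> (norm (a *\<^sub>R ?p i + b *\<^sub>R ?p j))\<^sup>2 - 1 = 0"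
      by (simp add: power2_eq_1_iff) (metis norm_ge_zero neg_0_le_iff_le not_one_le_zero)
    also have "\<dots> \<longleftrightarrow> a * t - b * s = 0"
      using * st by (metis (no_types, lifting) mult_eq_0_iff less_irrefl zero_eq_power2 zero_neq_numeral)
    finally show ?thesis by simp
  qed
  \<comment> \<open>This solves \<open>a * t = b * s\<close> with \<open>a + b = 1\<close>; both
    weights are positive, so the contact point lies on the segment itself.\<close>
  define m where "m = (s / (s + t)) *\<^sub>R ?p i + (t / (s + t)) *\<^sub>R ?p j"
  have w: "s / (s + t) + t / (s + t) = 1" using st by (simp flip: add_divide_distrib)
  have "m \<in> e"
    unfolding e2 m_def convex_hull_2 using w st by fastforce
  moreover have "affine hull e \<inter> sphere 0 1 = {m}"
  proof -
    have "affine hull e = affine hull {?p i, ?p j}" by (simp add: e2)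
    moreover have "x = m" if x: "x \<in> affine hull {?p i, ?p j}" "norm x = 1" for x
    proof -
      obtain a b where ab: "x = a *\<^sub>R ?p i + b *\<^sub>R ?p j" "a + b = 1"
        using x(1) unfolding affine_hull_2 by blast
      hence "a * t = b * s" using line x(2) by blast
      hence "a * (s + t) = s" "b * (s + t) = t" using ab(2) 
        by (simp_all add: algebra_simps) (metis distrib_left mult.commute mult.right_neutral add.commute)+
      hence "a = s / (s + t)" "b = t / (s + t)" using st by (simp_all add: field_simps)
      thus ?thesis by (simp add: ab(1) m_def)
    qed
    moreover have "norm m = 1" unfolding m_def using line[OF w] by simp
    moreover have "m \<in> affine hull {?p i, ?p j}"
      unfolding affine_hull_2 m_def using w by blast
    ultimately have "affine hull e \<inter> {x. norm x = 1} = {m}" by blast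
    moreover have "sphere (0::real^3) 1 = {x. norm x = 1}" by auto
    ultimately show ?thesis by (simp only:)
  qed
  ultimately show ?thesis unfolding tangent_to_unit_sphere_def by blast
qed

lemma vertex_coordinates_rational: "vertex_coordinates Q \<subseteq> \<rat>"
proof
  fix c assume "c \<in> vertex_coordinates Q"
  then obtain v k where v: "c = vec_nth v k" "v extreme_point_of Q" by (auto simp: vertex_coordinates_def)
  then obtain i where "i < n" "v = dehomogenize (U i)"
    using extreme_point_of_convex_hull by blast
  thus "c \<in> \<rat>" using rational[of i] v(1) by (simp add: rational_vector_def dehomogenize_def)
qed

end

section \<open>Copying the stackings of the given polytope\<close>

text \<open>The induction carries a frame of \<open>P\<close> and a packing with the same labels but
  unrelated coordinates. The facet over which \<open>P\<close> is stacked is identified by its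
  labels \<open>T\<close>, and the packing is stacked over the same \<open>T\<close>.\<close>

lemma stacking_packing:
  assumes "obtained_by_stacking P"
  shows "\<exists>n \<F> p M U N. facet_frame P n \<F> p M \<and> tangent_packing n \<F> U N"
  using assms
proof (induction rule: obtained_by_stacking.induct)
  case (tetrahedron T)
  thus ?case using simplex_frame_exists regular_packing by blast
next
  case (stack P F v)
  then obtain n \<F> p M U N where fr: "facet_frame P n \<F> p M" and pk: "tangent_packing n \<F> U N" by blast
  obtain T where T: "T \<in> \<F>" "lorentz (M T) (v, 1) > 0"
    "\<And>S. S \<in> \<F> \<Longrightarrow> S \<noteq> T \<Longrightarrow> lorentz (M S) (v, 1) < 0"
    using facet_frame.beyond_facet_signs[OF fr stack.hyps(2)] by blast
  show ?case
    using facet_frame.stack_frame_exists[OF fr T] tangent_packing.stack_packing[OF pk T(1)] by blast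
qed

section \<open>Fields generated by rational numbers\<close>

abbreviation real_ring :: "real ring" where
  "real_ring \<equiv> ring_of_type_algebra"

lemma real_ring_simps:
  "carrier real_ring = UNIV" "\<one>\<^bsub>real_ring\<^esub> = 1" "\<zero>\<^bsub>real_ring\<^esub> = 0"
  "a \<oplus>\<^bsub>real_ring\<^esub> b = a + b" "a \<otimes>\<^bsub>real_ring\<^esub> b = a * b"
  by (simp_all add: ring_of_type_algebra_def)

lemma field_real_ring: "field real_ring"
  by (rule field_from_type_algebra)

lemma uminus_real_ring: "\<ominus>\<^bsub>real_ring\<^esub> a = - a"
proof -
  interpret field real_ring by (rule field_real_ring)
  show ?thesis using minus_equality[of "- a" a] by (simp add: real_ring_simps)
qed

lemma inv_real_ring: "a \<noteq> 0 \<Longrightarrow> inv\<^bsub>real_ring\<^esub> a = inverse a"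
proof -
  interpret field real_ring by (rule field_real_ring)
  show "a \<noteq> 0 \<Longrightarrow> ?thesis" using comm_inv_char[of a "inverse a"] by (simp add: real_ring_simps)
qed

lemma subfield_Rats: "subfield \<rat> real_ring"
proof -
  interpret field real_ring by (rule field_real_ring)
  show ?thesis
  proof (intro subfieldI' subringI)
    fix k :: real assume "k \<in> \<rat> - {\<zero>\<^bsub>real_ring\<^esub>}"
    thus "inv\<^bsub>real_ring\<^esub> k \<in> \<rat>" by (simp add: real_ring_simps inv_real_ring)
  qed (simp_all add: real_ring_simps uminus_real_ring)
qed

text \<open>The rationals are a subfield containing \<open>H\<close>; conversely, every subfield
  contains 1, hence the integers and their quotients.\<close>

lemma generate_field_rational:
  assumes "H \<subseteq> \<rat>" shows "generate_field real_ring H = \<rat>"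
proof -
  interpret field real_ring by (rule field_real_ring)
  have "H \<subseteq> carrier real_ring" by (simp add: real_ring_simps)
  note sub = generate_field_is_subfield[OF this]
  have "generate_field real_ring H \<subseteq> \<rat>"
    using assms by (intro generate_field_min_subfield1 subfield_Rats) (simp_all add: real_ring_simps)
  moreover have "x \<in> generate_field real_ring H" if x: "x \<in> \<rat>" for x
  proof -
    note subr = subfieldE(1)[OF sub]
    have nat: "real k \<in> generate_field real_ring H" for k
    proof (induction k)
      case 0 thus ?case using subringE(2)[OF subr] by (simp add: real_ring_simps)
    next
      case (Suc k) thus ?case using subringE(7)[OF subr Suc subringE(3)[OF subr]]
        by (simp add: real_ring_simps add.commute)
    qed
    have int: "real_of_int k \<in> generate_field real_ring H" for k
    proof (cases k)
      case (nonneg m)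
      thus ?thesis using nat[of m] by simp
    next
      case (neg m)
      \<comment> \<open>The case \<open>neg m\<close> stands for the integer - (m + 1).\<close>
      hence "real_of_int k = \<ominus>\<^bsub>real_ring\<^esub> real (Suc m)" by (simp add: uminus_real_ring)
      thus ?thesis using subringE(5)[OF subr nat[of "Suc m"]] by (simp only:)
    qed
    obtain a b where "b \<noteq> 0" "x = real_of_int a / real_of_int b"
      using x unfolding Rats_eq_int_div_int by blast
    moreover from this have "inv\<^bsub>real_ring\<^esub> (real_of_int b) \<in> generate_field real_ring H"
      by (intro generate_field.m_inv int) (simp add: real_ring_simps)
    ultimately show ?thesis
      using subringE(6)[OF subr int[of a], of "inverse (real_of_int b)"]
      by (simp add: real_ring_simps inv_real_ring divide_real_def)
  qed
  ultimately show ?thesis by blast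
qed

text \<open>A space of dimension 0 is trivial, but the coordinate field contains 1. This bounds the
  infimum in \<open>koebe_degree\<close> from below.\<close>

lemma coordinate_degree_ge_1: "coordinate_degree R \<ge> 1"
proof (cases "ring.finite_dimension real_ring \<rat> (coordinate_field R)")
  case True
  interpret field real_ring by (rule field_real_ring)
  let ?d = "dim \<rat> (coordinate_field R)"
  have "dimension ?d \<rat> (coordinate_field R)"
    using finite_dimensionE[OF subfield_Rats True] by (simp add: over_def)
  moreover have "(1::real) \<in> coordinate_field R"
    using generate_field.one[of real_ring] by (simp add: coordinate_field_def real_ring_simps)
  ultimately have "?d \<noteq> 0"
    using dimension_zero[OF subfield_Rats, of "coordinate_field R"]
    by (metis real_ring_simps(3) singletonD zero_neq_one)
  thus ?thesis using True by (simp add: coordinate_degree_def one_enat_def)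
qed (simp add: coordinate_degree_def)

lemma coordinate_degree_rational:
  assumes "vertex_coordinates R \<subseteq> \<rat>" shows "coordinate_degree R = 1"
proof -
  interpret field real_ring by (rule field_real_ring)
  have "coordinate_field R = \<rat>" using generate_field_rational[OF assms] by (simp add: coordinate_field_def)
  moreover have "dimension 1 \<rat> \<rat>" by (rule dimension_one[OF subfield_Rats])
  moreover from this have "dim \<rat> \<rat> = 1" using dimI[OF subfield_Rats] by (simp add: over_def)
  ultimately show ?thesis
    using finite_dimensionI by (simp add: coordinate_degree_def one_enat_def)
qed

theorem theorem23:
  fixes P :: "(real^3) set"
  assumes "stacked_three_polytope P"
  shows "koebe_degree P = 1"
proof -
  obtain n \<F> p M U N where fr: "facet_frame P n \<F> p M" and pk: "tangent_packing n \<F> U N"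
    using stacking_packing assms unfolding stacked_three_polytope_def by blast
  interpret tangent_packing n \<F> U N by (rule pk)
  \<comment> \<open>The frames of \<open>P\<close> and \<open>Q\<close> share \<open>n\<close> and
    \<open>\<F>\<close>, which gives the combinatorial equivalence.\<close>
  have "koebe_realization P Q"
    unfolding koebe_realization_def realization_def
    using polytope_P combinatorially_equivalent_frames[OF fr frame] edge_tangent by blast
  moreover have "coordinate_degree Q = 1"
    by (rule coordinate_degree_rational[OF vertex_coordinates_rational])
  ultimately have "koebe_degree P \<le> 1" unfolding koebe_degree_def by (intro Inf_lower) auto
  moreover have "1 \<le> koebe_degree P"
    unfolding koebe_degree_def using coordinate_degree_ge_1 by (intro Inf_greatest) auto
  ultimately show ?thesis by simp
qed

end
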